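(* Let $m,n,\gamma$ be positive integers with $m\ge2$. Consider hyperkähler manifolds of $\mathrm{K3}^{[m]}$-type or of $\mathrm{Kum}_m$-type; set $\tilde m=m-1$ in the $\mathrm{K3}^{[m]}$-case and $\tilde m=m+1$ in the $\mathrm{Kum}_m$-case. Assume that $\gamma\mid\gcd(2\tilde m,2n)$. For a prime divisor $p$ of $\gamma$, set $\alpha=\min(v_p(\tilde m),v_p(n))$ and $\beta=v_p(\gamma)$, where $v_p$ is the $p$-adic valuation. Then there exists a polarization type $T$ of square $2n$ and divisibility $\gamma$ if and only if the following conditions hold for all prime divisors $p$ of $\gamma$: - if $v_p(\tilde m)\neq v_p(n)$, then $\beta\le\alpha/2$; - if $v_p(\tilde m)=v_p(n)=\alpha$, then either $\beta\le\alpha/2$, or $\beta>\alpha/2$ and $-n/\tilde m$ is a square modulo $p^{2\beta-\alpha}$. When these conditions hold, the total number of such polarization types $T$ is $\prod_{p\mid\gamma}N_p$ (product over the prime divisors of $\gamma$), where for $p\ge3$ $$N_p=\begin{cases}\frac12(p-1)p^{\beta-1}&\text{if }\beta\le\alpha/2,\\ p^{\alpha-\beta}&\text{if }\beta>\alpha/2,\end{cases}$$ and for $p=2$ $$N_2=\begin{cases}1&\text{if }\beta=1,\\ 2^{\beta-2}&\text{if }\beta\ge2,\ \beta\le\alpha/2+1,\\ 2^{\alpha+1-\beta}&\text{if }\beta>\alpha/2+1.\end{cases}$$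
   Context: For a hyperkähler manifold $X$, $H^2(X,\mathbf{Z})$ with the Beauville--Bogomolov--Fujiki form is isometric to a lattice $\Lambda$ depending only on the deformation type. For $\mathrm{K3}^{[m]}$-type (deformations of Hilbert schemes of $m$ points on K3 surfaces) $\Lambda=U^{\oplus3}\oplus E_8(-1)^{\oplus2}\oplus\langle-(2m-2)\rangle$; for $\mathrm{Kum}_m$-type (deformations of $2m$-dimensional generalized Kummer varieties) $\Lambda=U^{\oplus3}\oplus\langle-(2m+2)\rangle$. Here $U$ is the hyperbolic plane and $\langle k\rangle$ is generated by one vector of square $k$; in both cases $D(\Lambda)=\Lambda^\vee/\Lambda\simeq\mathbf{Z}/2\tilde m\mathbf{Z}$. A polarization type $T$ is an $\mathrm{O}(\Lambda)$-orbit of a primitive element of positive square in $\Lambda$ (the polarization type of $(X,H)$, with $H$ a primitive ample class, is the orbit of $\eta(H)$ for any isometry $\eta\colon H^2(X,\mathbf{Z})\to\Lambda$). The square of $T$ is $x^2=(x,x)$ for $x\in T$, and its divisibility is the positive generator of $(x,\Lambda)\subset\mathbf{Z}$ for $x\in T$. When $v_p(\tilde m)=v_p(n)$, $-n/\tilde m$ is a $p$-adic unit and "square modulo $p^{2\beta-\alpha}$" is understood in $\mathbf{Z}_{(p)}/p^{2\beta-\alpha}\simeq\mathbf{Z}/p^{2\beta-\alpha}\mathbf{Z}$. *)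

theory Defs
  imports Complex_Main "HOL-Library.Product_Plus" "HOL-Number_Theory.Number_Theory"
begin

text \<open>
  A lattice is given by its integral bilinear form on the additive group of a type. The lattices
  below live on products of copies of \<^typ>\<open>int\<close>, with componentwise addition.
\<close>

type_synonym 'a lattice_form = "'a \<Rightarrow> 'a \<Rightarrow> int"

definition direct_sum ::
    "'a lattice_form \<Rightarrow> 'b lattice_form \<Rightarrow> ('a \<times> 'b) lattice_form"  (infixr "\<oplus>\<^sub>L" 65)
  where "L \<oplus>\<^sub>L M = (\<lambda>(x, x') (y, y'). L x y + M x' y')"

definition rescale :: "int \<Rightarrow> 'a lattice_form \<Rightarrow> 'a lattice_form"
  where "rescale k L = (\<lambda>x y. k * L x y)"

definition U_form :: "(int \<times> int) lattice_form"
  where "U_form = (\<lambda>(a, b) (c, d). a * d + b * c)"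

definition rank_one_form :: "int \<Rightarrow> int lattice_form"
  where "rank_one_form k = (\<lambda>x y. k * x * y)"

type_synonym int8 = "int \<times> int \<times> int \<times> int \<times> int \<times> int \<times> int \<times> int"

text \<open>
  The positive definite lattice \<open>E\<^sub>8\<close> in the basis of simple roots, in Bourbaki's numbering:
  the Dynkin diagram is the chain 1-3-4-5-6-7-8 with 2 attached to 4.
\<close>

definition E8_form :: "int8 lattice_form"
  where "E8_form = (\<lambda>(x1, x2, x3, x4, x5, x6, x7, x8) (y1, y2, y3, y4, y5, y6, y7, y8).
    2 * (x1 * y1 + x2 * y2 + x3 * y3 + x4 * y4 + x5 * y5 + x6 * y6 + x7 * y7 + x8 * y8)
    - (x1 * y3 + x3 * y1) - (x3 * y4 + x4 * y3) - (x4 * y5 + x5 * y4) - (x5 * y6 + x6 * y5)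
    - (x6 * y7 + x7 * y6) - (x7 * y8 + x8 * y7) - (x2 * y4 + x4 * y2))"

definition K3_lattice ::
    "nat \<Rightarrow> ((int \<times> int) \<times> (int \<times> int) \<times> (int \<times> int) \<times> int8 \<times> int8 \<times> int) lattice_form"
  where "K3_lattice m = U_form \<oplus>\<^sub>L U_form \<oplus>\<^sub>L U_form \<oplus>\<^sub>L rescale (-1) E8_form \<oplus>\<^sub>L
    rescale (-1) E8_form \<oplus>\<^sub>L rank_one_form (- (2 * int m - 2))"

definition Kum_lattice ::
    "nat \<Rightarrow> ((int \<times> int) \<times> (int \<times> int) \<times> (int \<times> int) \<times> int) lattice_form"
  where "Kum_lattice m = U_form \<oplus>\<^sub>L U_form \<oplus>\<^sub>L U_form \<oplus>\<^sub>L rank_one_form (- (2 * int m + 2))"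

definition is_isometry ::
    "'a::ab_group_add lattice_form \<Rightarrow> 'b::ab_group_add lattice_form \<Rightarrow> ('a \<Rightarrow> 'b) \<Rightarrow> bool"
  where "is_isometry L M f \<longleftrightarrow>
    bij f \<and> (\<forall>x y. f (x + y) = f x + f y) \<and> (\<forall>x y. M (f x) (f y) = L x y)"

definition isometric ::
    "'a::ab_group_add lattice_form \<Rightarrow> 'b::ab_group_add lattice_form \<Rightarrow> bool"
  where "isometric L M \<longleftrightarrow> (\<exists>f. is_isometry L M f)"

definition orthogonal_group :: "'a::ab_group_add lattice_form \<Rightarrow> ('a \<Rightarrow> 'a) set"
  where "orthogonal_group L = {g. is_isometry L L g}"

definition isometry_orbit :: "'a::ab_group_add lattice_form \<Rightarrow> 'a \<Rightarrow> 'a set"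
  where "isometry_orbit L x = {g x |g. g \<in> orthogonal_group L}"

text \<open>The sum below is the multiple \<open>k \<cdot> y\<close>; in particular \<open>0\<close> is not primitive.\<close>

definition primitive :: "'a::ab_group_add \<Rightarrow> bool"
  where "primitive x \<longleftrightarrow> (\<forall>(k::nat) y. x = (\<Sum>i<k. y) \<longrightarrow> k = 1)"

definition has_divisibility :: "'a lattice_form \<Rightarrow> 'a \<Rightarrow> int \<Rightarrow> bool"
  where "has_divisibility L x d \<longleftrightarrow> d > 0 \<and> range (L x) = {d * k |k. True}"

definition polarization_types :: "'a::ab_group_add lattice_form \<Rightarrow> 'a set set"
  where "polarization_types L = {isometry_orbit L x |x. primitive x \<and> L x x > 0}"

definition polarization_types_of ::
    "'a::ab_group_add lattice_form \<Rightarrow> int \<Rightarrow> int \<Rightarrow> 'a set set"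
  where "polarization_types_of L s d =
    {T \<in> polarization_types L. \<forall>x\<in>T. L x x = s \<and> has_divisibility L x d}"

definition localization_at :: "nat \<Rightarrow> rat set"
  where "localization_at p = {of_int a / of_int b |a b. \<not> int p dvd b}"

text \<open>
  Squares in \<open>\<int>\<^sub>(\<^sub>p\<^sub>) / p\<^sup>k\<close>, for \<open>u\<close> in the localization \<open>\<int>\<^sub>(\<^sub>p\<^sub>)\<close> of \<open>\<int>\<close> at the prime \<open>p\<close>.
\<close>

definition is_square_mod_power :: "nat \<Rightarrow> nat \<Rightarrow> rat \<Rightarrow> bool"
  where "is_square_mod_power p k u \<longleftrightarrow>
    (\<exists>z\<in>localization_at p. \<exists>w\<in>localization_at p. u - z\<^sup>2 = of_nat p ^ k * w)"

text \<open>In the next two definitions \<open>mt\<close> stands for \<open>m - 1\<close> or \<open>m + 1\<close> and \<open>g\<close> for the divisibility.\<close>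

definition local_condition :: "nat \<Rightarrow> nat \<Rightarrow> nat \<Rightarrow> nat \<Rightarrow> bool"
  where "local_condition mt n g p \<longleftrightarrow>
    (let \<alpha> = min (multiplicity p mt) (multiplicity p n); \<beta> = multiplicity p g in
      (multiplicity p mt \<noteq> multiplicity p n \<longrightarrow> real \<beta> \<le> real \<alpha> / 2) \<and>
      (multiplicity p mt = multiplicity p n \<longrightarrow>
        real \<beta> \<le> real \<alpha> / 2 \<or>
        real \<beta> > real \<alpha> / 2 \<and>
          is_square_mod_power p (2 * \<beta> - \<alpha>) (- of_nat n / of_nat mt)))"

text \<open>
  If \<open>p\<close> divides \<open>g\<close> and \<open>g\<close> divides \<open>gcd (2 * mt) (2 * n)\<close>, then the natural-number division and
  subtractions below are exact: \<open>\<beta> \<ge> 1\<close>, and \<open>\<beta> \<le> \<alpha>\<close> for odd \<open>p\<close>, while \<open>\<beta> \<le> \<alpha> + 1\<close> for \<open>p = 2\<close>.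
\<close>

definition local_count :: "nat \<Rightarrow> nat \<Rightarrow> nat \<Rightarrow> nat \<Rightarrow> nat"
  where "local_count mt n g p =
    (let \<alpha> = min (multiplicity p mt) (multiplicity p n); \<beta> = multiplicity p g in
      if p = 2 then
        (if \<beta> = 1 then 1
         else if real \<beta> \<le> real \<alpha> / 2 + 1 then 2 ^ (\<beta> - 2)
         else 2 ^ (\<alpha> + 1 - \<beta>))
      else
        (if real \<beta> \<le> real \<alpha> / 2 then (p - 1) * p ^ (\<beta> - 1) div 2
         else p ^ (\<alpha> - \<beta>)))"

end

theory Submission
  imports Defs
begin

text \<open>
  Write \<open>t\<close> for \<open>mt\<close>. Both lattices have the form \<open>U + U + \<langle>-2t\<rangle> + N\<close> with \<open>N\<close> even and unimodular
  (\<open>N = U\<close>, respectively \<open>N = U + E\<^sub>8(-1) + E\<^sub>8(-1)\<close>), and the two copies of \<open>U\<close> allow an Eichler-type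
  argument that brings vectors into a normal form. Let \<open>x\<close> have divisibility \<open>\<gamma>\<close> and square \<open>2n\<close>, and let
  \<open>c\<close> be any integer congruent modulo \<open>\<gamma>\<close> to its coordinate on the generator \<open>l\<close> of \<open>\<langle>-2t\<rangle>\<close>. Then \<open>x\<close> is
  equivalent under \<open>O(\<Lambda>)\<close> to \<open>X\<^sub>c = \<gamma> e + ((n + t c\<^sup>2) / \<gamma>) f + c l\<close>, where \<open>e, f\<close> is the standard basis of
  the first \<open>U\<close>, and \<open>\<gamma>\<^sup>2\<close> divides \<open>n + t c\<^sup>2\<close> (\<open>linked_normal_form\<close>). Moreover \<open>X\<^sub>c\<close> is primitive exactly
  if \<open>c\<close> is coprime to \<open>\<gamma>\<close>. The types of square \<open>2n\<close> and divisibility \<open>\<gamma>\<close> are thus the orbits of the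
  \<open>X\<^sub>c\<close> for the units \<open>c\<close> modulo \<open>\<gamma>\<close> that satisfy this divisibility.

  Two such \<open>c\<close> give the same orbit if and only if they agree up to sign modulo every prime power
  \<open>p\<^sup>\<beta>\<close> exactly dividing \<open>\<gamma>\<close> (\<open>orbit_normal_form_iff\<close>). On the one hand, an isometry maps \<open>l\<close> to
  \<open>u l\<close> plus \<open>2t\<close> times a vector, and comparing squares gives \<open>u\<^sup>2 = 1\<close> modulo \<open>4t\<close>
  (\<open>isometry_ell\<close>), so that \<open>u\<close> is \<open>1\<close> or \<open>-1\<close> modulo each \<open>p\<^sup>\<beta>\<close>. On the other hand, for every factorization \<open>t = P Q\<close> into
  coprime factors, the Atkin--Lehner matrix of determinant \<open>P\<close> acts on \<open>U + \<langle>-2t\<rangle>\<close> as an isometry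
  for which \<open>u\<close> is congruent to \<open>-1\<close> modulo \<open>2P\<close> and to \<open>1\<close> modulo \<open>2Q\<close> (\<open>isometry_atkin_lehner\<close>). Hence the signs can be chosen independently
  at all primes.

  By the Chinese remainder theorem the number of types is then the product over the primes \<open>p\<close>
  dividing \<open>\<gamma>\<close> of the number of units \<open>c\<close> modulo \<open>p\<^sup>\<beta>\<close>, up to sign, such that \<open>p\<^sup>2\<^sup>\<beta>\<close> divides
  \<open>n + t c\<^sup>2\<close>. That is an elementary count: either the condition is void, or it forces \<open>t\<close> and \<open>n\<close>
  to have the same valuation \<open>\<alpha>\<close> at \<open>p\<close> and says that \<open>c\<close> is a square root of \<open>-n/t\<close> modulo \<open>p\<close> to
  the power \<open>2\<beta> - \<alpha>\<close> (\<open>card_locally_admissible\<close>).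
\<close>

section \<open>Integer multiples in an abelian group\<close>

definition zmult :: "int \<Rightarrow> 'a::ab_group_add \<Rightarrow> 'a"
  where "zmult k x = (\<Sum>i<nat k. x) - (\<Sum>i<nat (- k). x)"

lemma zmult_of_nat: "zmult (int k) x = (\<Sum>i<k. x)"
  by (simp add: zmult_def)

lemma const_sum_add:
  fixes x :: "'a::ab_group_add"
  shows "(\<Sum>i<a + b. x) = (\<Sum>i<a. x) + (\<Sum>i<(b::nat). x)"
  by (induction b) (simp_all add: algebra_simps)

text \<open>
  The truncations in the definition cancel, so every way of writing an integer as a difference of two
  natural numbers computes the same multiple; additivity in the integer follows at once.
\<close>

lemma zmult_diff_of_nat: "zmult (int a - int b) x = (\<Sum>i<a. x) - (\<Sum>i<b. x)"
proof (cases "b \<le> a")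
  case True
  then show ?thesis
    using const_sum_add[of x "a - b" b] by (simp add: zmult_def nat_diff_distrib)
next
  case False
  then show ?thesis
    using const_sum_add[of x "b - a" a] by (simp add: zmult_def nat_diff_distrib)
qed

lemma zmult_add_left: "zmult (a + b) x = zmult a x + zmult b x"
proof -
  obtain a1 a2 b1 b2 where ab: "a = int a1 - int a2" "b = int b1 - int b2"
    using int_diff_cases by metis
  have "a + b = int (a1 + b1) - int (a2 + b2)"
    by (simp add: ab)
  then show ?thesis
    unfolding ab by (simp only: zmult_diff_of_nat const_sum_add) (simp add: algebra_simps)
qed

lemma zmult_0 [simp]: "zmult 0 x = 0"
  and zmult_1 [simp]: "zmult 1 x = x"
  and zmult_minus_left: "zmult (- a) x = - zmult a x"
  by (simp_all add: zmult_def)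

lemma zmult_zero_right [simp]: "zmult k 0 = 0"
  by (simp add: zmult_def)

lemma additive_zmult:
  assumes add: "\<And>x y. h (x + y) = h x + h y"
  shows "h (zmult k x) = zmult k (h x)"
proof -
  interpret additive h
    by (simp add: additive_def add)
  show ?thesis
    by (simp add: zmult_def diff sum)
qed

lemma zmult_int [simp]: "zmult k x = k * x" for x :: int
  by (simp add: zmult_def)

lemma zmult_minus_right: "zmult k (- x) = - zmult k x"
  using additive_zmult[of uminus k x] by simp

lemma zmult_pair [simp]: "zmult k (x, y) = (zmult k x, zmult k y)"
  using additive_zmult[of fst k "(x, y)"] additive_zmult[of snd k "(x, y)"]
  by (simp add: prod_eq_iff)

lemma primitive_iff_zmult: "primitive x \<longleftrightarrow> (\<forall>(k::nat) y. x = zmult (int k) y \<longrightarrow> k = 1)"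
  by (simp add: primitive_def zmult_of_nat)

section \<open>Isometries and polarization types\<close>

lemma is_isometryI:
  assumes "\<And>x. f' (f x) = x" "\<And>x. f (f' x) = x"
    and "\<And>x y. f (x + y) = f x + f y" "\<And>x y. M (f x) (f y) = L x y"
  shows "is_isometry L M f"
  using assms unfolding is_isometry_def by (auto intro: bij_betw_byWitness)

lemma is_isometry_id: "is_isometry L L (\<lambda>x. x)"
  by (auto intro: is_isometryI)

lemma is_isometry_comp:
  assumes "is_isometry L M f" "is_isometry M P g"
  shows "is_isometry L P (\<lambda>x. g (f x))"
  using assms bij_comp[of f g] by (auto simp: is_isometry_def o_def)

lemma is_isometry_inverse:
  assumes "is_isometry L M f"
  obtains f' where "is_isometry M L f'" "\<And>x. f' (f x) = x" "\<And>y. f (f' y) = y"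
proof
  have f: "bij f" "\<And>x y. f (x + y) = f x + f y" "\<And>x y. M (f x) (f y) = L x y"
    using assms by (auto simp: is_isometry_def)
  let ?g = "inv_into UNIV f"
  show gf: "?g (f x) = x" and fg: "f (?g y) = y" for x y
    using f(1) by (simp_all add: bij_is_surj surj_f_inv_f bij_is_inj)
  show "is_isometry M L ?g"
  proof (rule is_isometryI)
    show "?g (x + y) = ?g x + ?g y" for x y
      by (metis f(2) gf fg)
    show "L (?g x) (?g y) = M x y" for x y
      by (metis f(3) fg)
  qed (fact fg gf)+
qed

lemma isometric_trans: "isometric L M \<Longrightarrow> isometric M P \<Longrightarrow> isometric L P"
  unfolding isometric_def using is_isometry_comp by blast

lemma in_isometry_orbit: "y \<in> isometry_orbit L x \<longleftrightarrow> (\<exists>g. is_isometry L L g \<and> g x = y)"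
  by (auto simp: isometry_orbit_def orthogonal_group_def)

lemma isometry_orbit_refl: "x \<in> isometry_orbit L x"
  unfolding in_isometry_orbit using is_isometry_id by blast

lemma isometry_orbit_sym: "y \<in> isometry_orbit L x \<Longrightarrow> x \<in> isometry_orbit L y"
  unfolding in_isometry_orbit by (metis is_isometry_inverse)

lemma isometry_orbit_trans:
  "y \<in> isometry_orbit L x \<Longrightarrow> z \<in> isometry_orbit L y \<Longrightarrow> z \<in> isometry_orbit L x"
  unfolding in_isometry_orbit using is_isometry_comp by blast

lemma isometry_orbit_eq_iff: "isometry_orbit L x = isometry_orbit L y \<longleftrightarrow> y \<in> isometry_orbit L x"
  using isometry_orbit_refl isometry_orbit_sym isometry_orbit_trans by fast

lemma is_isometry_primitive:
  assumes "is_isometry L M f"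
  shows "primitive (f x) \<longleftrightarrow> primitive x"
proof -
  obtain f' where f': "is_isometry M L f'" "\<And>x. f' (f x) = x"
    using is_isometry_inverse[OF assms] by metis
  have "f (zmult k y) = zmult k (f y)" "f' (zmult k z) = zmult k (f' z)" for k y z
    using assms f'(1) by (auto simp: is_isometry_def intro!: additive_zmult)
  then show ?thesis
    unfolding primitive_iff_zmult using f'(2) by metis
qed

lemma is_isometry_has_divisibility:
  assumes "is_isometry L M f"
  shows "has_divisibility M (f x) d \<longleftrightarrow> has_divisibility L x d"
proof -
  have "range f = UNIV"
    using assms by (simp add: is_isometry_def bij_def)
  then have "range (M (f x)) = range (\<lambda>y. M (f x) (f y))"
    by (metis image_image)
  also have "\<dots> = range (L x)"
    using assms by (simp add: is_isometry_def)
  finally show ?thesis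
    by (simp add: has_divisibility_def)
qed

lemma has_divisibility_dvd:
  assumes "has_divisibility L x d"
  shows "d dvd L x y"
proof -
  have "L x y \<in> {d * k |k. True}"
    using assms unfolding has_divisibility_def by (metis rangeI)
  then show ?thesis
    by auto
qed

lemma has_divisibility_attained:
  assumes "has_divisibility L x d"
  shows "\<exists>y. L x y = d"
proof -
  have "d * 1 \<in> range (L x)"
    using assms unfolding has_divisibility_def by blast
  then show ?thesis
    by auto
qed

lemma polarization_types_of_eq:
  assumes "s > 0"
  shows "polarization_types_of L s d =
    isometry_orbit L ` {x. primitive x \<and> L x x = s \<and> has_divisibility L x d}"
proof -
  have "L y y = L x x \<and> has_divisibility L y d = has_divisibility L x d"
    if "y \<in> isometry_orbit L x" for x y
    using that is_isometry_has_divisibility unfolding in_isometry_orbit is_isometry_def by metis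
  then show ?thesis
    using assms isometry_orbit_refl
    unfolding polarization_types_of_def polarization_types_def by blast
qed

lemma isometry_orbit_image:
  assumes "is_isometry L M f"
  shows "isometry_orbit M (f x) = f ` isometry_orbit L x"
proof -
  obtain f' where f': "is_isometry M L f'" and [simp]: "\<And>x. f' (f x) = x" "\<And>y. f (f' y) = y"
    using is_isometry_inverse[OF assms] by metis
  show ?thesis
  proof (intro equalityI subsetI)
    fix y assume "y \<in> isometry_orbit M (f x)"
    then obtain g where g: "is_isometry M M g" "g (f x) = y"
      by (auto simp: in_isometry_orbit)
    then have "f' y \<in> isometry_orbit L x"
      using is_isometry_comp[OF is_isometry_comp[OF assms g(1)] f'] by (auto simp: in_isometry_orbit)
    then show "y \<in> f ` isometry_orbit L x"
      by (metis \<open>\<And>y. f (f' y) = y\<close> imageI)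
  next
    fix y assume "y \<in> f ` isometry_orbit L x"
    then obtain g where g: "is_isometry L L g" "f (g x) = y"
      by (auto simp: in_isometry_orbit)
    then show "y \<in> isometry_orbit M (f x)"
      using is_isometry_comp[OF is_isometry_comp[OF f' g(1)] assms]
      unfolding in_isometry_orbit by (intro exI[of _ "\<lambda>z. f (g (f' z))"]) simp
  qed
qed

text \<open>
  The theorem speaks of an arbitrary lattice isometric to one of the two explicit ones. Everything
  that it counts is carried along an isometry, so the count can be done in a convenient model.
\<close>

lemma isometric_polarization_types:
  assumes "isometric L M" "s > 0"
  obtains F where "bij_betw F (polarization_types_of L s d) (polarization_types_of M s d)"
proof -
  obtain f where f: "is_isometry L M f"
    using assms by (auto simp: isometric_def)
  have "inj f" and surj: "surj f" and form: "\<And>x y. M (f x) (f y) = L x y"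
    using f by (auto simp: is_isometry_def bij_def)
  let ?V = "\<lambda>L. {x. primitive x \<and> L x x = s \<and> has_divisibility L x d}"
  have "?V M = f ` ?V L"
  proof (intro equalityI subsetI)
    fix y assume y: "y \<in> ?V M"
    obtain x where "y = f x"
      using surj by (auto simp: surj_def)
    then show "y \<in> f ` ?V L"
      using y is_isometry_primitive[OF f] is_isometry_has_divisibility[OF f] form by auto
  next
    fix y assume "y \<in> f ` ?V L"
    then show "y \<in> ?V M"
      using is_isometry_primitive[OF f] is_isometry_has_divisibility[OF f] form by auto
  qed
  then have "polarization_types_of M s d = (`) f ` polarization_types_of L s d"
    by (simp add: polarization_types_of_eq[OF assms(2)] image_image isometry_orbit_image[OF f])
  moreover have "inj ((`) f)"
    using \<open>inj f\<close> by (simp add: inj_def inj_image_eq_iff)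
  ultimately show ?thesis
    using that inj_on_imp_bij_betw[OF inj_on_subset[OF _ subset_UNIV]] by metis
qed

section \<open>Even unimodular lattices\<close>

text \<open>
  Unimodularity is stated in the form in which it is used: a functional \<open>N x\<close> divisible by \<open>d\<close> comes from
  a vector divisible by \<open>d\<close>. This avoids bases and determinants, and is inherited by direct sums.
\<close>

locale even_unimodular =
  fixes N :: "'n::ab_group_add lattice_form"
  assumes add: "N (x + y) z = N x z + N y z"
    and sym: "N x y = N y x"
    and even: "even (N x x)"
    and unimodular: "(\<And>y. d dvd N x y) \<Longrightarrow> \<exists>y. x = zmult d y"
begin

lemma add_right: "N x (y + z) = N x y + N x z"
  using add[of y z x] by (simp add: sym)

lemma zmult_left: "N (zmult k x) y = k * N x y"
  using additive_zmult[of "\<lambda>x. N x y"] by (simp add: add)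

lemma zmult_right: "N x (zmult k y) = k * N x y"
  using zmult_left[of k y x] by (simp add: sym)

lemma zero_left [simp]: "N 0 y = 0"
  using zmult_left[of 0 0 y] by simp

lemma zero_right [simp]: "N x 0 = 0"
  using zmult_right[of x 0 0] by simp

lemma minus_left: "N (- x) y = - N x y"
  using zmult_left[of "-1" x y] by (simp add: zmult_minus_left)

lemma minus_right: "N x (- y) = - N x y"
  using minus_left[of y x] by (simp add: sym)

lemmas bilinear = add add_right zmult_left zmult_right minus_left minus_right

end

lemma even_unimodular_U: "even_unimodular U_form"
proof
  fix d :: int and x :: "int \<times> int"
  assume d: "\<And>y. d dvd U_form x y"
  obtain a b where x: "x = (a, b)"
    by fastforce
  have "d dvd a" "d dvd b"
    using d[of "(0, 1)"] d[of "(1, 0)"] by (simp_all add: x U_form_def)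
  then show "\<exists>y. x = zmult d y"
    by (auto simp: x dvd_def)
qed (auto simp: U_form_def algebra_simps)

lemma even_unimodular_direct_sum:
  assumes "even_unimodular L" "even_unimodular M"
  shows "even_unimodular (L \<oplus>\<^sub>L M)"
proof -
  interpret L: even_unimodular L by fact
  interpret M: even_unimodular M by fact
  show ?thesis
  proof
    fix d x
    assume d: "\<And>y. d dvd (L \<oplus>\<^sub>L M) x y"
    obtain a b where x: "x = (a, b)"
      by fastforce
    have "d dvd L a y" "d dvd M b z" for y z
      using d[of "(y, 0)"] d[of "(0, z)"] by (simp_all add: x direct_sum_def)
    then obtain a' b' where "a = zmult d a'" "b = zmult d b'"
      using L.unimodular M.unimodular by metis
    then have "x = zmult d (a', b')"
      by (simp add: x)
    then show "\<exists>y. x = zmult d y" ..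
  qed (auto simp: direct_sum_def L.add M.add L.even M.even split: prod.splits
      intro: arg_cong2[where f = "(+)"] L.sym M.sym)
qed

lemma even_unimodular_E8: "even_unimodular (rescale (-1) E8_form)"
proof
  fix d :: int and x :: int8
  assume d: "\<And>y. d dvd rescale (-1) E8_form x y"
  obtain x1 x2 x3 x4 x5 x6 x7 x8 where x: "x = (x1, x2, x3, x4, x5, x6, x7, x8)"
    by (metis prod.collapse)
  \<comment> \<open>the vectors paired with \<open>x\<close> are the fundamental weights, the basis dual to the simple roots\<close>
  have "d dvd x1" "d dvd x2" "d dvd x3" "d dvd x4" "d dvd x5" "d dvd x6" "d dvd x7" "d dvd x8"
    using d[of "(4, 5, 7, 10, 8, 6, 4, 2)"] d[of "(5, 8, 10, 15, 12, 9, 6, 3)"]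
      d[of "(7, 10, 14, 20, 16, 12, 8, 4)"] d[of "(10, 15, 20, 30, 24, 18, 12, 6)"]
      d[of "(8, 12, 16, 24, 20, 15, 10, 5)"] d[of "(6, 9, 12, 18, 15, 12, 8, 4)"]
      d[of "(4, 6, 8, 12, 10, 8, 6, 3)"] d[of "(2, 3, 4, 6, 5, 4, 3, 2)"]
    by (simp_all add: x rescale_def E8_form_def)
  then have "x = zmult d (x1 div d, x2 div d, x3 div d, x4 div d, x5 div d, x6 div d, x7 div d, x8 div d)"
    by (simp add: x)
  then show "\<exists>y. x = zmult d y" ..
qed (auto simp: rescale_def E8_form_def algebra_simps split: prod.splits)

section \<open>The lattice \<open>U + U + \<langle>-2t\<rangle> + N\<close>\<close>

type_synonym 'n std = "(int \<times> int) \<times> (int \<times> int) \<times> int \<times> 'n"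

definition std_lattice :: "int \<Rightarrow> 'n lattice_form \<Rightarrow> 'n std lattice_form"
  where "std_lattice t N = U_form \<oplus>\<^sub>L U_form \<oplus>\<^sub>L rank_one_form (- 2 * t) \<oplus>\<^sub>L N"

lemma std_lattice_eq:
  "std_lattice t N ((a, b), (c, d), k, v) ((a', b'), (c', d'), k', v') =
    (a * b' + b * a') + (c * d' + d * c') - 2 * t * k * k' + N v v'"
  by (simp add: std_lattice_def direct_sum_def U_form_def rank_one_form_def)

lemma Kum_lattice_isometric:
  "isometric (Kum_lattice m) (std_lattice (int (m + 1)) U_form)"
  unfolding isometric_def
proof
  let ?f = "\<lambda>(p, q, r, k). (p, q, k, r)" and ?f' = "\<lambda>(p, q, k, r). (p, q, r, k)"
  show "is_isometry (Kum_lattice m) (std_lattice (int (m + 1)) U_form) ?f"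
    by (rule is_isometryI[where f' = ?f'])
      (auto simp: Kum_lattice_def std_lattice_def direct_sum_def rank_one_form_def algebra_simps)
qed

lemma K3_lattice_isometric:
  assumes "m \<ge> 1"
  shows "isometric (K3_lattice m) (std_lattice (int (m - 1))
    (U_form \<oplus>\<^sub>L rescale (-1) E8_form \<oplus>\<^sub>L rescale (-1) E8_form))"
    (is "isometric _ ?M")
  unfolding isometric_def
proof
  let ?f = "\<lambda>(p, q, r, u, v, k). (p, q, k, r, u, v)" and ?f' = "\<lambda>(p, q, k, r, u, v). (p, q, r, u, v, k)"
  show "is_isometry (K3_lattice m) ?M ?f"
    using assms by (intro is_isometryI[where f' = ?f'])
      (auto simp: K3_lattice_def std_lattice_def direct_sum_def rank_one_form_def algebra_simps of_nat_diff
        split: prod.splits)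
qed

locale eichler_lattice = even_unimodular N for N :: "'n::ab_group_add lattice_form" +
  fixes t :: int
  assumes t_pos: "t > 0"
begin

abbreviation \<Lambda> :: "'n std lattice_form"
  where "\<Lambda> \<equiv> std_lattice t N"

definition ell :: "'n std \<Rightarrow> int"
  where "ell = (\<lambda>(p, q, k, v). k)"

lemma ell_simps [simp]: "ell (p, q, k, v) = k"
  by (simp add: ell_def)

text \<open>
  For a vector \<open>x\<close> of divisibility \<open>\<gamma>\<close>, the coordinate on \<open>l\<close> modulo \<open>\<gamma>\<close> determines the class of \<open>x / \<gamma>\<close>
  in the discriminant group. The isometries used to reach the normal form preserve that class, which has to
  be recorded because it is what parametrizes the normal forms.
\<close>

definition linked :: "int \<Rightarrow> 'n std \<Rightarrow> 'n std \<Rightarrow> bool"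
  where "linked \<gamma> x y \<longleftrightarrow> y \<in> isometry_orbit \<Lambda> x \<and> [ell y = ell x] (mod \<gamma>)"

lemma linked_refl: "linked \<gamma> x x"
  by (simp add: linked_def isometry_orbit_refl)

lemma linked_trans: "linked \<gamma> x y \<Longrightarrow> linked \<gamma> y z \<Longrightarrow> linked \<gamma> x z"
  unfolding linked_def using isometry_orbit_trans cong_trans by blast

lemma linkedI:
  assumes "is_isometry \<Lambda> \<Lambda> g" "g x = y" "[ell y = ell x] (mod \<gamma>)"
  shows "linked \<gamma> x y"
  using assms by (auto simp: linked_def in_isometry_orbit)

lemma linked_inv:
  assumes "linked \<gamma> x y"
  shows "\<Lambda> y y = \<Lambda> x x" "has_divisibility \<Lambda> y d \<longleftrightarrow> has_divisibility \<Lambda> x d"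
  using assms is_isometry_has_divisibility unfolding linked_def in_isometry_orbit is_isometry_def by metis+

lemma linked_swap: "linked \<gamma> (p, q, kv) (q, p, kv)"
proof (rule linkedI)
  let ?g = "\<lambda>(p, q, kv). (q, p, kv)"
  show "is_isometry \<Lambda> \<Lambda> ?g"
    by (rule is_isometryI[where f' = ?g]) (auto simp: std_lattice_eq)
  show "?g (p, q, kv) = (q, p, kv)"
    by simp
qed (cases kv; simp)

lemma linked_flip: "linked \<gamma> (p, (c, d), kv) (p, (d, c), kv)"
proof (rule linkedI)
  let ?g = "\<lambda>(p, (c, d), kv). (p, (d, c), kv)"
  show "is_isometry \<Lambda> \<Lambda> ?g"
    by (rule is_isometryI[where f' = ?g]) (auto simp: std_lattice_eq)
  show "?g (p, (c, d), kv) = (p, (d, c), kv)"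
    by simp
qed (cases kv; simp)

lemma linked_flip': "linked \<gamma> ((a, b), q, kv) ((b, a), q, kv)"
  using linked_trans[OF linked_trans[OF linked_swap linked_flip] linked_swap] .

lemma linked_neg: "linked \<gamma> ((a, b), q, kv) ((- a, - b), q, kv)"
proof (rule linkedI)
  let ?g = "\<lambda>((a, b), q, kv). ((- a, - b), q, kv)"
  show "is_isometry \<Lambda> \<Lambda> ?g"
    by (rule is_isometryI[where f' = ?g]) (auto simp: std_lattice_eq)
  show "?g ((a, b), q, kv) = ((- a, - b), q, kv)"
    by simp
qed (cases kv; simp)

text \<open>
  On \<open>U + U\<close>, seen as the integral \<open>2 \<times> 2\<close> matrices with the determinant as quadratic form, this is an
  elementary column operation. Together with the permutations above it allows Euclidean division
  among the four coordinates.
\<close>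

lemma linked_shear: "linked \<gamma> ((a, b), (c, d), kv) ((a, b + r * d), (c - r * a, d), kv)"
proof (rule linkedI)
  let ?g = "\<lambda>r ((a, b), (c, d), kv). ((a, b + r * d), (c - r * a, d), kv)"
  show "is_isometry \<Lambda> \<Lambda> (?g r)"
    by (rule is_isometryI[where f' = "?g (- r)"]) (auto simp: std_lattice_eq algebra_simps)
  show "?g r ((a, b), (c, d), kv) = ((a, b + r * d), (c - r * a, d), kv)"
    by simp
qed (cases kv; simp)

text \<open>
  The Eichler transvection attached to the isotropic vector \<open>f\<close> of the first \<open>U\<close> and the vector
  \<open>j l + w\<close>, which is orthogonal to \<open>f\<close>. The last coefficient is half the square of \<open>j l + w\<close>, an integer
  because \<open>N\<close> is even.
\<close>

definition transvection :: "int \<Rightarrow> 'n \<Rightarrow> 'n std \<Rightarrow> 'n std"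
  where "transvection j w = (\<lambda>((a, b), q, k, v).
    ((a, b - (N v w - 2 * t * k * j) - a * (N w w div 2 - t * j\<^sup>2)), q, k + a * j, v + zmult a w))"

lemma isometry_transvection: "is_isometry \<Lambda> \<Lambda> (transvection j w)"
proof (rule is_isometryI)
  have half: "2 * (N w w div 2) = N w w"
    using even by simp
  have inv: "transvection j w (transvection (- j) (- w) x) = x" for j w x
  proof -
    obtain a b c d k v where x: "x = ((a, b), (c, d), k, v)"
      by (metis prod.collapse)
    have "2 * (N w w div 2) = N w w"
      using even by simp
    then have "a * N w w = a * (N w w div 2) + a * (N w w div 2)"
      by (metis mult_2 mult.left_commute)
    moreover have "zmult a (- w) + zmult a w = 0"
      by (simp add: zmult_minus_right)
    ultimately show ?thesis
      by (simp add: x transvection_def bilinear algebra_simps power2_eq_square)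
  qed
  then show "transvection j w (transvection (- j) (- w) x) = x" for x .
  show "transvection (- j) (- w) (transvection j w x) = x" for x
    using inv[of "- j" "- w" x] by simp
  show "transvection j w (x + y) = transvection j w x + transvection j w y" for x y
    by (cases x; cases y) (auto simp: transvection_def bilinear zmult_add_left algebra_simps)
  show "\<Lambda> (transvection j w x) (transvection j w y) = \<Lambda> x y" for x y
  proof -
    obtain a b c d k v where x: "x = ((a, b), (c, d), k, v)"
      by (metis prod.collapse)
    obtain a' b' c' d' k' v' where y: "y = ((a', b'), (c', d'), k', v')"
      by (metis prod.collapse)
    have "a * (a' * N w w) = a * (a' * (N w w div 2)) + a * (a' * (N w w div 2))"
      using half by (metis mult_2 mult.left_commute)
    then show ?thesis
      by (simp add: x y transvection_def std_lattice_eq bilinear sym[of w v'] algebra_simps power2_eq_square)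
  qed
qed

text \<open>
  The class modulo \<open>\<gamma>\<close> is preserved since the coordinate on \<open>l\<close> changes by a multiple of \<open>a\<close>.
\<close>

lemma linked_transvection:
  assumes "\<gamma> dvd a"
  shows "linked \<gamma> ((a, b), q, k, v)
    ((a, b - (N v w - 2 * t * k * j) - a * (N w w div 2 - t * j\<^sup>2)), q, k + a * j, v + zmult a w)"
proof (rule linkedI[OF isometry_transvection])
  show "transvection j w ((a, b), q, k, v) =
    ((a, b - (N v w - 2 * t * k * j) - a * (N w w div 2 - t * j\<^sup>2)), q, k + a * j, v + zmult a w)"
    by (simp add: transvection_def)
qed (use assms in \<open>simp add: cong_iff_dvd_diff\<close>)

section \<open>A normal form for vectors of given square and divisibility\<close>

definition normal_form :: "int \<Rightarrow> int \<Rightarrow> int \<Rightarrow> 'n std"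
  where "normal_form \<gamma> n c = ((\<gamma>, (n + t * c\<^sup>2) div \<gamma>), (0, 0), c, 0)"

text \<open>
  Among all vectors linked to \<open>x\<close>, take one whose first coordinate \<open>a\<close> is positive and minimal.
  Minimality, the shears and the permutations force \<open>a\<close> to divide the other hyperbolic coordinates, two
  of which can therefore be cleared. A transvection then turns every pairing of the remaining part with
  \<open>\<langle>-2t\<rangle> + N\<close> into a hyperbolic coordinate, so \<open>a\<close> divides those pairings as well. Hence \<open>a\<close> is the
  divisibility \<open>\<gamma>\<close>. By unimodularity the component in \<open>N\<close> is a multiple of \<open>\<gamma>\<close>, and one more transvection
  removes it and moves the coordinate on \<open>l\<close> to any prescribed representative modulo \<open>\<gamma>\<close>. The last free
  coordinate is determined by the square.
\<close>

lemma linked_normal_form: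
  assumes div: "has_divisibility \<Lambda> x \<gamma>" and sq: "\<Lambda> x x = 2 * n" and c: "[c = ell x] (mod \<gamma>)"
  shows "\<gamma>\<^sup>2 dvd n + t * c\<^sup>2" "linked \<gamma> x (normal_form \<gamma> n c)"
proof -
  have \<gamma>: "\<gamma> > 0"
    using div by (simp add: has_divisibility_def)
  have divy: "\<gamma> dvd \<Lambda> y z" if "linked \<gamma> x y" for y z
    using linked_inv(2)[OF that] div has_divisibility_dvd by metis
  define P where "P a \<longleftrightarrow> (\<exists>b q kv. linked \<gamma> x ((int a, b), q, kv))" for a
  have entry: "P (nat \<bar>a\<bar>)" if "linked \<gamma> x ((a, b), q, kv)" for a b q kv
  proof (cases "a \<ge> 0")
    case True
    then have "linked \<gamma> x ((int (nat \<bar>a\<bar>), b), q, kv)"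
      using that by simp
    then show ?thesis
      unfolding P_def by blast
  next
    case False
    then have "linked \<gamma> x ((int (nat \<bar>a\<bar>), - b), q, kv)"
      using linked_trans[OF that linked_neg] by simp
    then show ?thesis
      unfolding P_def by blast
  qed
  \<comment> \<open>if all hyperbolic coordinates vanished, transvections would show that \<open>x\<close> is orthogonal to everything\<close>
  have "\<exists>a>0. P a"
  proof (rule ccontr)
    assume none: "\<not> (\<exists>a>0. P a)"
    have zero: "a = 0" if "linked \<gamma> x ((a, b), q, kv)" for a b q kv
      using entry[OF that] none by (metis zero_less_nat_eq zero_less_abs_iff)
    obtain a b c d k v where x: "x = ((a, b), (c, d), k, v)"
      by (metis prod.collapse)
    have "a = 0"
      using zero[of a b "(c, d)" "(k, v)"] linked_refl[of \<gamma> x] by (simp add: x)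
    moreover have "b = 0"
      using zero[of b a "(c, d)" "(k, v)"] linked_flip'[of \<gamma> a b "(c, d)" "(k, v)"] by (simp add: x)
    moreover have "c = 0"
      using zero[of c d "(a, b)" "(k, v)"] linked_swap[of \<gamma> "(a, b)" "(c, d)" "(k, v)"] by (simp add: x)
    moreover have "d = 0"
      using zero[of d c "(a, b)" "(k, v)"]
        linked_trans[OF linked_flip[of \<gamma> "(a, b)" c d "(k, v)"] linked_swap] by (simp add: x)
    ultimately have x0: "x = ((0, 0), (0, 0), k, v)"
      by (simp add: x)
    have "N v w - 2 * t * k * j = 0" for w j
    proof -
      have "linked \<gamma> x ((- (N v w - 2 * t * k * j), 0), (0, 0), k, v)"
        using linked_trans[OF linked_transvection[of \<gamma> 0 0 "(0, 0)" k v w j] linked_flip'] by (simp add: x0)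
      from zero[OF this] show ?thesis
        by simp
    qed
    then have "\<Lambda> x y = 0" for y
      by (cases y) (auto simp: x0 std_lattice_eq)
    then show False
      using has_divisibility_attained[OF div] \<gamma> by simp
  qed
  define a where "a = (LEAST a. a > 0 \<and> P a)"
  have a: "a > 0" "P a"
    using LeastI_ex[OF \<open>\<exists>a>0. P a\<close>] by (simp_all add: a_def)
  have least: "a \<le> a'" if "a' > 0" "P a'" for a'
    unfolding a_def using that by (intro Least_le) simp
  \<comment> \<open>otherwise a shear and a swap put the smaller remainder of \<open>c\<close> modulo \<open>a\<close> in first place\<close>
  have third: "int a dvd c" if "linked \<gamma> x ((int a, b), (c, d), kv)" for b c d kv
  proof -
    have "linked \<gamma> x ((c mod int a, d), (int a, b + c div int a * d), kv)"
      using linked_trans[OF linked_trans[OF that linked_shear[where r = "c div int a"]] linked_swap]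
      by (simp add: minus_div_mult_eq_mod)
    then have P: "P (nat \<bar>c mod int a\<bar>)"
      by (rule entry)
    have "0 \<le> c mod int a" "c mod int a < int a"
      using a(1) by simp_all
    with P least[of "nat \<bar>c mod int a\<bar>"] show ?thesis
      by (cases "c mod int a = 0") (auto simp: dvd_eq_mod_eq_0)
  qed
  have fourth: "int a dvd d" if "linked \<gamma> x ((int a, b), (c, d), kv)" for b c d kv
    using third[OF linked_trans[OF that linked_flip]] .
  obtain b0 c0 d0 kv where "linked \<gamma> x ((int a, b0), (c0, d0), kv)"
    using a(2) by (auto simp: P_def)
  moreover obtain k v where kv: "kv = (k, v)"
    by fastforce
  ultimately have lk: "linked \<gamma> x ((int a, b0), (c0, d0), k, v)"
    by simp
  obtain b1 where "linked \<gamma> x ((int a, b1), (0, d0), k, v)"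
    using linked_trans[OF lk linked_shear[where r = "c0 div int a"]] third[OF lk] by auto
  note lk = linked_trans[OF this linked_flip]
  have lk: "linked \<gamma> x ((int a, b1), (0, 0), k, v)"
    using linked_trans[OF lk linked_shear[where r = "d0 div int a"]] third[OF lk] by simp
  \<comment> \<open>a shear copies the second coordinate to the third place\<close>
  have "linked \<gamma> x ((int a, b1), (b1, 0), k, v)"
    using linked_trans[OF linked_trans[OF linked_trans[OF lk linked_flip']
        linked_shear[where r = "- 1"]] linked_flip'] by simp
  then have second: "int a dvd b1"
    by (rule third)
  have pairing: "int a dvd N v w - 2 * t * k * j" for w j
  proof -
    have "linked \<gamma> x ((0, - (N v w - 2 * t * k * j)), (int a, b1), k, v)"
      using linked_trans[OF linked_trans[OF lk linked_swap] linked_transvection[where w = w and j = j]] by simp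
    from fourth[OF linked_trans[OF this linked_swap]] show ?thesis
      by (simp only: dvd_minus_iff)
  qed
  let ?y = "((int a, b1), (0, 0), k, v)"
  have "int a dvd \<Lambda> ?y z" for z
  proof -
    obtain a' b' c' d' j w where z: "z = ((a', b'), (c', d'), j, w)"
      by (metis prod.collapse)
    have "\<Lambda> ?y z = int a * b' + b1 * a' + (N v w - 2 * t * k * j)"
      by (simp add: z std_lattice_eq)
    then show ?thesis
      using second pairing by (metis dvd_add dvd_mult2 dvd_triv_left)
  qed
  then have "int a dvd \<gamma>"
    using linked_inv(2)[OF lk] div has_divisibility_attained by metis
  moreover have "\<gamma> dvd int a"
    using divy[OF lk, of "((0, 1), (0, 0), 0, 0)"] by (simp add: std_lattice_eq)
  ultimately have a_eq: "int a = \<gamma>"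
    using \<gamma> by (simp add: zdvd_antisym_nonneg)
  have "\<gamma> dvd N v w" for w
    using divy[OF lk, of "((0, 0), (0, 0), 0, w)"] by (simp add: std_lattice_eq)
  then obtain v0 where v0: "v = zmult \<gamma> v0"
    using unimodular by blast
  have "[c = k] (mod \<gamma>)"
    using lk c cong_trans cong_sym by (fastforce simp: linked_def)
  then obtain j where j: "c = k + \<gamma> * j"
    using cong_sym[of c k \<gamma>] unfolding cong_iff_lin by blast
  define B where "B = b1 - (N v (- v0) - 2 * t * k * j) - \<gamma> * (N (- v0) (- v0) div 2 - t * j\<^sup>2)"
  have lk: "linked \<gamma> x ((\<gamma>, B), (0, 0), c, 0)"
    using linked_trans[OF lk[unfolded a_eq] linked_transvection[where w = "- v0" and j = j]]
    by (simp add: B_def j v0 zmult_minus_right)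
  have "n + t * c\<^sup>2 = \<gamma> * B"
    using linked_inv(1)[OF lk] sq by (simp add: std_lattice_eq power2_eq_square mult.assoc mult.commute[of B])
  moreover have "\<gamma> dvd B"
    using divy[OF lk, of "((1, 0), (0, 0), 0, 0)"] by (simp add: std_lattice_eq)
  ultimately show "\<gamma>\<^sup>2 dvd n + t * c\<^sup>2" "linked \<gamma> x (normal_form \<gamma> n c)"
    using lk \<gamma> by (auto simp: normal_form_def power2_eq_square)
qed


lemma normal_form_in_orbit:
  assumes "has_divisibility \<Lambda> x \<gamma>" "\<Lambda> x x = 2 * n"
  shows "normal_form \<gamma> n (ell x) \<in> isometry_orbit \<Lambda> x" "\<gamma>\<^sup>2 dvd n + t * (ell x)\<^sup>2"
  using linked_normal_form[OF assms cong_refl] by (simp_all add: linked_def)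

definition admissible :: "int \<Rightarrow> int \<Rightarrow> int \<Rightarrow> bool"
  where "admissible \<gamma> n c \<longleftrightarrow> coprime c \<gamma> \<and> \<gamma>\<^sup>2 dvd n + t * c\<^sup>2"

lemma normal_form_eq:
  assumes "\<gamma> > 0" "\<gamma>\<^sup>2 dvd n + t * c\<^sup>2"
  obtains B where "n + t * c\<^sup>2 = \<gamma> * (\<gamma> * B)" "normal_form \<gamma> n c = ((\<gamma>, \<gamma> * B), (0, 0), c, 0)"
proof -
  obtain B where B: "n + t * c\<^sup>2 = \<gamma>\<^sup>2 * B"
    using assms(2) by (rule dvdE)
  show thesis
    by (rule that[of B]) (use assms(1) B in \<open>simp_all add: normal_form_def power2_eq_square mult.assoc\<close>)
qed

lemma normal_form_square_divisibility:
  assumes "\<gamma> > 0" "\<gamma> dvd 2 * t" "\<gamma>\<^sup>2 dvd n + t * c\<^sup>2"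
  shows "\<Lambda> (normal_form \<gamma> n c) (normal_form \<gamma> n c) = 2 * n"
    and "has_divisibility \<Lambda> (normal_form \<gamma> n c) \<gamma>"
proof -
  obtain B where B: "n + t * c\<^sup>2 = \<gamma> * (\<gamma> * B)"
    and nf: "normal_form \<gamma> n c = ((\<gamma>, \<gamma> * B), (0, 0), c, 0)"
    using normal_form_eq[OF assms(1,3)] by metis
  show "\<Lambda> (normal_form \<gamma> n c) (normal_form \<gamma> n c) = 2 * n"
    using B by (simp add: nf std_lattice_eq algebra_simps power2_eq_square)
  have "\<gamma> dvd \<Lambda> (normal_form \<gamma> n c) y" for y
  proof -
    obtain a' b' c' d' j w where y: "y = ((a', b'), (c', d'), j, w)"
      by (metis prod.collapse)
    have "\<Lambda> (normal_form \<gamma> n c) y = \<gamma> * (b' + B * a') - 2 * t * (c * j)"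
      by (simp add: nf y std_lattice_eq algebra_simps)
    then show ?thesis
      using assms(2) by (metis dvd_diff dvd_mult2 dvd_triv_left)
  qed
  then have "range (\<Lambda> (normal_form \<gamma> n c)) \<subseteq> {\<gamma> * k |k. True}"
    by (auto simp: dvd_def)
  moreover have "{\<gamma> * k |k. True} \<subseteq> range (\<Lambda> (normal_form \<gamma> n c))"
  proof clarify
    fix k
    have "\<gamma> * k = \<Lambda> (normal_form \<gamma> n c) ((0, k), (0, 0), 0, 0)"
      by (simp add: nf std_lattice_eq)
    then show "\<gamma> * k \<in> range (\<Lambda> (normal_form \<gamma> n c))"
      by (metis rangeI)
  qed
  ultimately show "has_divisibility \<Lambda> (normal_form \<gamma> n c) \<gamma>"
    using assms(1) unfolding has_divisibility_def by blast
qed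

lemma primitive_normal_form_iff:
  assumes "\<gamma> > 0" "\<gamma>\<^sup>2 dvd n + t * c\<^sup>2"
  shows "primitive (normal_form \<gamma> n c) \<longleftrightarrow> coprime c \<gamma>"
proof -
  obtain B where B: "n + t * c\<^sup>2 = \<gamma> * (\<gamma> * B)"
    and nf: "normal_form \<gamma> n c = ((\<gamma>, \<gamma> * B), (0, 0), c, 0)"
    using normal_form_eq[OF assms] by metis
  show ?thesis
  proof
    assume prim: "primitive (normal_form \<gamma> n c)"
    define k where "k = gcd c \<gamma>"
    have k: "k > 0" "k dvd c" "k dvd \<gamma>"
      using assms(1) by (simp_all add: k_def)
    then have "normal_form \<gamma> n c = zmult (int (nat k)) ((\<gamma> div k, \<gamma> div k * B), (0, 0), c div k, 0)"
      by (simp add: nf flip: mult.assoc)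
    then have "nat k = 1"
      using prim unfolding primitive_iff_zmult by blast
    then show "coprime c \<gamma>"
      by (simp add: k_def coprime_iff_gcd_eq_1)
  next
    assume cop: "coprime c \<gamma>"
    show "primitive (normal_form \<gamma> n c)"
      unfolding primitive_iff_zmult
    proof (intro allI impI)
      fix k :: nat and y assume "normal_form \<gamma> n c = zmult (int k) y"
      moreover obtain a' b' q j w where "y = ((a', b'), q, j, w)"
        by (metis prod.collapse)
      ultimately have "int k dvd \<gamma>" "int k dvd c"
        by (auto simp: nf)
      then show "k = 1"
        using coprime_common_divisor[OF cop, of "int k"] by simp
    qed
  qed
qed

text \<open>
  Reaching every type uses the normal form; that every admissible parameter gives a type uses
  \<open>\<gamma> dvd 2 * t\<close>, without which the divisibility of the normal form would be too small.
\<close>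

lemma polarization_types_of_std:
  assumes "n > 0" "\<gamma> > 0" "\<gamma> dvd 2 * t"
  shows "polarization_types_of \<Lambda> (2 * n) \<gamma> =
    (\<lambda>c. isometry_orbit \<Lambda> (normal_form \<gamma> n c)) ` {c. admissible \<gamma> n c}"
proof (intro equalityI subsetI)
  fix T assume "T \<in> polarization_types_of \<Lambda> (2 * n) \<gamma>"
  then obtain x where x: "T = isometry_orbit \<Lambda> x" "primitive x" "\<Lambda> x x = 2 * n" "has_divisibility \<Lambda> x \<gamma>"
    using assms(1) by (auto simp: polarization_types_of_eq)
  note nf = normal_form_in_orbit[OF x(4,3)]
  have "primitive (normal_form \<gamma> n (ell x))"
    using nf(1) x(2) is_isometry_primitive unfolding in_isometry_orbit by metis
  then have "admissible \<gamma> n (ell x)"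
    using primitive_normal_form_iff[OF assms(2) nf(2)] nf(2) by (simp add: admissible_def)
  moreover have "T = isometry_orbit \<Lambda> (normal_form \<gamma> n (ell x))"
    using nf(1) x(1) by (simp add: isometry_orbit_eq_iff)
  ultimately show "T \<in> (\<lambda>c. isometry_orbit \<Lambda> (normal_form \<gamma> n c)) ` {c. admissible \<gamma> n c}"
    by blast
next
  fix T assume "T \<in> (\<lambda>c. isometry_orbit \<Lambda> (normal_form \<gamma> n c)) ` {c. admissible \<gamma> n c}"
  then obtain c where c: "T = isometry_orbit \<Lambda> (normal_form \<gamma> n c)" "coprime c \<gamma>" "\<gamma>\<^sup>2 dvd n + t * c\<^sup>2"
    by (auto simp: admissible_def)
  then show "T \<in> polarization_types_of \<Lambda> (2 * n) \<gamma>"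
    using normal_form_square_divisibility[OF assms(2,3) c(3)] primitive_normal_form_iff[OF assms(2) c(3)]
      assms(1) by (auto simp: polarization_types_of_eq)
qed

text \<open>
  The generator \<open>l\<close> of \<open>\<langle>-2t\<rangle>\<close> has divisibility \<open>2t\<close>, hence so has its image, which by unimodularity is
  \<open>u l\<close> plus \<open>2t\<close> times a vector of the even lattice orthogonal to \<open>l\<close>. Comparing squares gives the
  congruence for \<open>u\<close>. The normal form is \<open>c l\<close> plus a multiple of \<open>\<gamma>\<close>, which explains the second claim.
\<close>

lemma isometry_ell:
  assumes g: "is_isometry \<Lambda> \<Lambda> g"
  obtains u where "[u\<^sup>2 = 1] (mod 4 * t)"
    and "\<And>\<gamma> n c. \<gamma> > 0 \<Longrightarrow> \<gamma>\<^sup>2 dvd n + t * c\<^sup>2 \<Longrightarrow> [ell (g (normal_form \<gamma> n c)) = u * c] (mod \<gamma>)"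
proof -
  have form: "\<Lambda> (g x) (g y) = \<Lambda> x y" and add: "g (x + y) = g x + g y" and "bij g" for x y
    using g unfolding is_isometry_def by blast+
  let ?l = "((0, 0), (0, 0), 1, 0) :: 'n std"
  obtain a b c d u v where z: "g ?l = ((a, b), (c, d), u, v)"
    by (metis prod.collapse)
  have dvd: "2 * t dvd \<Lambda> (g ?l) y" for y
  proof -
    obtain y' where "y = g y'"
      using \<open>bij g\<close> unfolding bij_def surj_def by blast
    then show ?thesis
      by (cases y') (auto simp: form std_lattice_eq)
  qed
  have "2 * t dvd a" "2 * t dvd b" "2 * t dvd c" "2 * t dvd d"
    using dvd[of "((0, 1), (0, 0), 0, 0)"] dvd[of "((1, 0), (0, 0), 0, 0)"]
      dvd[of "((0, 0), (0, 1), 0, 0)"] dvd[of "((0, 0), (1, 0), 0, 0)"]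
    by (simp_all add: z std_lattice_eq)
  moreover have "2 * t dvd N v w" for w
    using dvd[of "((0, 0), (0, 0), 0, w)"] by (simp add: z std_lattice_eq)
  ultimately obtain a' b' c' d' v' where
    abcd: "a = 2 * t * a'" "b = 2 * t * b'" "c = 2 * t * c'" "d = 2 * t * d'" "v = zmult (2 * t) v'"
    using unimodular[of "2 * t" v] by (metis dvdE)
  define h where "h = N v' v' div 2"
  have h: "N v' v' = 2 * h"
    using even by (simp add: h_def)
  have "\<Lambda> (g ?l) (g ?l) = - (2 * t)"
    by (simp only: form) (simp add: std_lattice_eq)
  then have "(2 * t) * u\<^sup>2 = (2 * t) * (1 + 4 * t * (a' * b' + c' * d' + h))"
    by (simp add: z abcd std_lattice_eq bilinear h algebra_simps power2_eq_square)
  then have "u\<^sup>2 = 1 + 4 * t * (a' * b' + c' * d' + h)"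
    using t_pos by (simp only: mult_cancel_left) simp
  then have "[u\<^sup>2 = 1] (mod 4 * t)"
    by (simp add: cong_iff_dvd_diff)
  moreover have "[ell (g (normal_form \<gamma> n c)) = u * c] (mod \<gamma>)"
    if \<gamma>: "\<gamma> > 0" "\<gamma>\<^sup>2 dvd n + t * c\<^sup>2" for \<gamma> n c
  proof -
    obtain B where nf: "normal_form \<gamma> n c = ((\<gamma>, \<gamma> * B), (0, 0), c, 0)"
      using normal_form_eq[OF \<gamma>] by metis
    let ?y = "((1, B), (0, 0), 0, 0) :: 'n std"
    have ell_add: "ell (g (x + y)) = ell (g x) + ell (g y)" for x y
      unfolding add by (cases "g x"; cases "g y") (auto simp: ell_def split: prod.splits)
    have "normal_form \<gamma> n c = zmult \<gamma> ?y + zmult c ?l"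
      by (simp add: nf)
    then have "ell (g (normal_form \<gamma> n c)) = \<gamma> * ell (g ?y) + c * u"
      using additive_zmult[of "\<lambda>x. ell (g x)", OF ell_add]
      by (simp only: ell_add zmult_int) (simp add: z)
    then show ?thesis
      by (simp add: cong_iff_dvd_diff algebra_simps)
  qed
  ultimately show thesis
    using that by blast
qed

text \<open>
  Identify the point \<open>(c, d)\<close> of the second \<open>U\<close> together with \<open>k l\<close> with the symmetric matrix \<open>S\<close> with
  rows \<open>(c, t k)\<close> and \<open>(t k, t d)\<close>, whose determinant is \<open>t / 2\<close> times the square of the vector. For
  \<open>t = P Q\<close> and \<open>P w - Q y = 1\<close> the matrix \<open>W\<close> with rows \<open>(P, y)\<close> and \<open>(t, P w)\<close> has determinant \<open>P\<close>, and
  the map below is \<open>S \<mapsto> W S W\<^sup>T / P\<close>.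
\<close>

definition atkin_lehner :: "int \<Rightarrow> int \<Rightarrow> int \<Rightarrow> int \<Rightarrow> 'n std \<Rightarrow> 'n std"
  where "atkin_lehner P Q w y = (\<lambda>(p, (c, d), k, v).
    (p, (P * c + 2 * t * y * k + Q * y\<^sup>2 * d, Q * c + 2 * t * w * k + P * w\<^sup>2 * d),
     c + (P * w + Q * y) * k + w * y * d, v))"

lemma isometry_atkin_lehner:
  assumes t: "t = P * Q" and det: "P * w - Q * y = 1"
  shows "is_isometry \<Lambda> \<Lambda> (atkin_lehner P Q w y)"
proof (rule is_isometryI)
  \<comment> \<open>the map given by the adjugate of \<open>W\<close>\<close>
  let ?f' = "\<lambda>(p, (c, d), k, v). (p, (P * w\<^sup>2 * c - 2 * t * w * y * k + Q * y\<^sup>2 * d,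
    Q * c - 2 * t * k + P * d), - w * c + (P * w + Q * y) * k - y * d, v)"
  \<comment> \<open>each coordinate identity below holds up to the factor \<open>(P w - Q y)\<^sup>2\<close>, the squared determinant\<close>
  have scale: "a = b" if "a = (P * w - Q * y)\<^sup>2 * b" for a b
    using that det by simp
  show "?f' (atkin_lehner P Q w y x) = x" for x
  proof -
    obtain p c d k v where x: "x = (p, (c, d), k, v)"
      by (metis prod.collapse)
    show ?thesis
      unfolding x atkin_lehner_def prod.case prod.inject unfolding t
      by (intro conjI refl; rule scale; simp add: algebra_simps power2_eq_square)
  qed
  show "atkin_lehner P Q w y (?f' x) = x" for x
  proof -
    obtain p c d k v where x: "x = (p, (c, d), k, v)"
      by (metis prod.collapse)
    show ?thesis
      unfolding x atkin_lehner_def prod.case prod.inject unfolding t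
      by (intro conjI refl; rule scale; simp add: algebra_simps power2_eq_square)
  qed
  show "atkin_lehner P Q w y (x + x') = atkin_lehner P Q w y x + atkin_lehner P Q w y x'" for x x'
    by (cases x; cases x') (auto simp: atkin_lehner_def algebra_simps)
  show "\<Lambda> (atkin_lehner P Q w y x) (atkin_lehner P Q w y x') = \<Lambda> x x'" for x x'
  proof -
    obtain a b c d k v where x: "x = ((a, b), (c, d), k, v)"
      by (metis prod.collapse)
    obtain a' b' c' d' k' v' where x': "x' = ((a', b'), (c', d'), k', v')"
      by (metis prod.collapse)
    let ?u = "P * w + Q * y"
    have "(P * c + 2 * (P * Q) * y * k + Q * y\<^sup>2 * d) * (Q * c' + 2 * (P * Q) * w * k' + P * w\<^sup>2 * d')
        + (Q * c + 2 * (P * Q) * w * k + P * w\<^sup>2 * d) * (P * c' + 2 * (P * Q) * y * k' + Q * y\<^sup>2 * d')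
        - 2 * (P * Q) * (c + ?u * k + w * y * d) * (c' + ?u * k' + w * y * d')
      = c * d' + d * c' - 2 * (P * Q) * k * k'"
      by (rule scale) (simp add: algebra_simps power2_eq_square)
    then show ?thesis
      unfolding x x' atkin_lehner_def prod.case std_lattice_eq unfolding t
      by (metis (no_types) add_diff_eq)
  qed
qed

text \<open>
  The Atkin--Lehner isometry fixes the first \<open>U\<close> and multiplies the coordinate on \<open>l\<close>. It takes the
  normal form out of normal form, to which the previous reduction returns it with the new class.
\<close>

lemma orbit_normal_form_mult:
  assumes "t = P * Q" "P * w - Q * y = 1"
    and \<gamma>: "\<gamma> > 0" "\<gamma> dvd 2 * t" "\<gamma>\<^sup>2 dvd n + t * c\<^sup>2"
    and c': "[c' = (P * w + Q * y) * c] (mod \<gamma>)"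
  shows "normal_form \<gamma> n c' \<in> isometry_orbit \<Lambda> (normal_form \<gamma> n c)"
proof -
  let ?g = "atkin_lehner P Q w y"
  note iso = isometry_atkin_lehner[OF assms(1,2)]
  have "has_divisibility \<Lambda> (?g (normal_form \<gamma> n c)) \<gamma>"
    using normal_form_square_divisibility(2)[OF \<gamma>] is_isometry_has_divisibility[OF iso] by simp
  moreover have "\<Lambda> (?g (normal_form \<gamma> n c)) (?g (normal_form \<gamma> n c)) = 2 * n"
    using normal_form_square_divisibility(1)[OF \<gamma>] iso unfolding is_isometry_def by metis
  moreover have "ell (?g (normal_form \<gamma> n c)) = (P * w + Q * y) * c"
    by (simp add: atkin_lehner_def normal_form_def)
  ultimately have "normal_form \<gamma> n c' \<in> isometry_orbit \<Lambda> (?g (normal_form \<gamma> n c))"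
    using linked_normal_form(2)[of "?g (normal_form \<gamma> n c)" \<gamma> n c'] c' by (simp add: linked_def)
  moreover have "?g (normal_form \<gamma> n c) \<in> isometry_orbit \<Lambda> (normal_form \<gamma> n c)"
    using iso by (auto simp: in_isometry_orbit)
  ultimately show ?thesis
    using isometry_orbit_trans by blast
qed

end

section \<open>Residues up to sign\<close>

definition sign_class :: "int \<Rightarrow> int \<Rightarrow> int set"
  where "sign_class q c = {c mod q, (- c) mod q}"

lemma sign_class_eq_iff:
  "sign_class q c = sign_class q c' \<longleftrightarrow> [c = c'] (mod q) \<or> [c = - c'] (mod q)"
proof
  assume "sign_class q c = sign_class q c'"
  then have "c mod q \<in> sign_class q c'"
    by (metis sign_class_def insertI1)
  then show "[c = c'] (mod q) \<or> [c = - c'] (mod q)"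
    by (auto simp: sign_class_def cong_def)
next
  assume "[c = c'] (mod q) \<or> [c = - c'] (mod q)"
  then show "sign_class q c = sign_class q c'"
  proof
    assume c: "[c = c'] (mod q)"
    then have "[- c = - c'] (mod q)"
      by (simp add: cong_minus_minus_iff)
    with c show ?thesis
      by (simp add: sign_class_def cong_def)
  next
    assume c: "[c = - c'] (mod q)"
    then have "[- c = c'] (mod q)"
      by (metis cong_minus_minus_iff minus_minus)
    with c show ?thesis
      by (simp add: sign_class_def cong_def insert_commute)
  qed
qed

text \<open>
  If the elements of \<open>R\<close> and their negatives are pairwise incongruent modulo \<open>m\<close>, each class up to
  sign modulo \<open>m s\<close> has exactly one representative that reduces to an element of \<open>R\<close> modulo \<open>m\<close>, and every
  residue modulo \<open>m\<close> has \<open>s\<close> lifts. Hence no division by two is needed, and all local counts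
  come from this one.
\<close>

lemma card_sign_classes:
  fixes m s :: nat and R :: "int set"
  assumes s: "s > 0" and m: "m > 0"
    and inj: "\<And>r r'. r \<in> R \<Longrightarrow> r' \<in> R \<Longrightarrow> [r = r'] (mod int m) \<Longrightarrow> r = r'"
    and sign: "\<And>r r'. r \<in> R \<Longrightarrow> r' \<in> R \<Longrightarrow> \<not> [r = - r'] (mod int m)"
  shows "card (sign_class (int (m * s)) ` {c. \<exists>r\<in>R. [c = r] (mod int m) \<or> [c = - r] (mod int m)}) =
    card R * s"
proof -
  let ?q = "int (m * s)"
  let ?f = "\<lambda>(r, i). sign_class ?q (r + int m * int i)"
  let ?S = "{c. \<exists>r\<in>R. [c = r] (mod int m) \<or> [c = - r] (mod int m)}"
  have "inj_on ?f (R \<times> {..<s})"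
  proof (rule inj_onI, clarify)
    fix r i r' i'
    assume R: "r \<in> R" "r' \<in> R" and i: "i < s" "i' < s"
      and eq: "sign_class ?q (r + int m * int i) = sign_class ?q (r' + int m * int i')"
    have mq: "int m dvd ?q"
      by simp
    have "\<not> [r + int m * int i = - (r' + int m * int i')] (mod ?q)"
    proof
      assume "[r + int m * int i = - (r' + int m * int i')] (mod ?q)"
      then have "[r + int m * int i = - (r' + int m * int i')] (mod int m)"
        using mq cong_dvd_modulus by blast
      then have "int m dvd (r - (- r')) + int m * (int i + int i')"
        by (simp add: cong_iff_dvd_diff algebra_simps)
      then have "[r = - r'] (mod int m)"
        unfolding cong_iff_dvd_diff by (metis dvd_add_left_iff dvd_triv_left)
      then show False
        using sign R by blast
    qed
    then have c: "[r + int m * int i = r' + int m * int i'] (mod ?q)"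
      using eq by (simp add: sign_class_eq_iff)
    then have "int m dvd (r - r') + int m * (int i - int i')"
      using mq by (auto simp: cong_iff_dvd_diff algebra_simps dest: dvd_trans[OF mq])
    then have "[r = r'] (mod int m)"
      unfolding cong_iff_dvd_diff by (metis dvd_add_left_iff dvd_triv_left)
    then have rr: "r = r'"
      using inj R by blast
    have "int m * int s dvd int m * (int i - int i')"
      using c by (simp add: rr cong_iff_dvd_diff algebra_simps)
    then have "[int i = int i'] (mod int s)"
      using m by (simp add: cong_iff_dvd_diff)
    then show "r = r' \<and> i = i'"
      using i rr by (simp add: cong_int_iff cong_def)
  qed
  moreover have "?f ` (R \<times> {..<s}) = sign_class ?q ` ?S"
  proof (intro equalityI subsetI)
    fix X assume "X \<in> ?f ` (R \<times> {..<s})"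
    then obtain r i where "r \<in> R" "X = sign_class ?q (r + int m * int i)"
      by auto
    moreover have "[r + int m * int i = r] (mod int m)"
      by (simp add: cong_iff_dvd_diff)
    ultimately show "X \<in> sign_class ?q ` ?S"
      by blast
  next
    fix X assume "X \<in> sign_class ?q ` ?S"
    then obtain c r where c: "X = sign_class ?q c" and r: "r \<in> R"
      and "[c = r] (mod int m) \<or> [c = - r] (mod int m)"
      by blast
    then obtain c' where c': "X = sign_class ?q c'" "[c' = r] (mod int m)"
    proof (elim disjE)
      assume "[c = - r] (mod int m)"
      then have "[- c = r] (mod int m)"
        by (metis cong_minus_minus_iff minus_minus)
      moreover have "X = sign_class ?q (- c)"
        using c by (simp add: sign_class_eq_iff)
      ultimately show thesis
        using that by blast
    qed (use that in blast)
    obtain k where k: "c' = r + int m * k"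
      using cong_sym[OF c'(2)] unfolding cong_iff_lin by blast
    define i where "i = nat (k mod int s)"
    have i: "i < s" "int i = k mod int s"
      using s by (simp_all add: i_def nat_less_iff)
    have "k - int i = int s * (k div int s)"
      by (simp add: i(2) minus_mod_eq_mult_div)
    then have "int m * (k - int i) = ?q * (k div int s)"
      by simp
    then have "[c' = r + int m * int i] (mod ?q)"
      unfolding cong_iff_dvd_diff k by (simp add: right_diff_distrib del: of_nat_mult)
    then have "X = ?f (r, i)"
      using c'(1) by (simp add: sign_class_eq_iff)
    then show "X \<in> ?f ` (R \<times> {..<s})"
      using r i(1) by blast
  qed
  ultimately have "card (sign_class ?q ` ?S) = card (R \<times> {..<s})"
    using card_image[of ?f "R \<times> {..<s}"] by (simp only:)
  then show ?thesis
    by (simp only: card_cartesian_product card_lessThan)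
qed

text \<open>
  For odd \<open>p\<close> only one of \<open>b - a\<close> and \<open>b + a\<close> can be divisible by \<open>p\<close>. For \<open>p = 2\<close> both are even, and
  exactly one of their halves is even, which costs one power of \<open>2\<close>.
\<close>

lemma prime_power_dvd_square_diff:
  fixes p :: nat and a b :: int
  assumes p: "prime p" and a: "\<not> int p dvd a" and b: "\<not> int p dvd b"
    and dvd: "int p ^ (k + (if p = 2 then 1 else 0)) dvd b\<^sup>2 - a\<^sup>2"
  shows "[b = a] (mod int p ^ k) \<or> [b = - a] (mod int p ^ k)"
proof (cases "p = 2")
  case False
  have "\<not> (int p dvd b - a \<and> int p dvd b + a)"
  proof
    assume "int p dvd b - a \<and> int p dvd b + a"
    then have "int p dvd 2 * a"
      using dvd_diff[of "int p" "b + a" "b - a"] by simp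
    then have "int p dvd 2"
      using p a by (simp add: prime_dvd_mult_iff)
    then have "p dvd 2"
      using int_dvd_int_iff[of p 2] by simp
    then show False
      using p False by (simp add: primes_dvd_imp_eq)
  qed
  moreover have "int p ^ k dvd (b - a) * (b + a)"
    using dvd False by (simp add: power2_eq_square algebra_simps)
  moreover have "coprime (int p ^ k) x" if "\<not> int p dvd x" for x
    using p that by (simp add: prime_imp_coprime)
  ultimately have "int p ^ k dvd b - a \<or> int p ^ k dvd b + a"
    by (metis coprime_dvd_mult_left_iff coprime_dvd_mult_right_iff)
  then show ?thesis
    by (simp add: cong_iff_dvd_diff)
next
  case True
  have "even (b - a)" "even (b + a)"
    using a b True by simp_all
  then obtain x y where xy: "b - a = 2 * x" "b + a = 2 * y"
    unfolding dvd_def by blast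
  have y: "y = x + a"
    using xy by simp
  show ?thesis
  proof (cases k)
    case (Suc l)
    have "2 ^ Suc (Suc l) dvd (b - a) * (b + a)"
      using dvd True Suc by (simp add: power2_eq_square algebra_simps)
    then have "2 * 2 * 2 ^ l dvd 2 * 2 * (x * y)"
      by (simp add: xy)
    then have "2 ^ l dvd x * y"
      by simp
    moreover have "coprime (2 ^ l) x \<or> coprime (2 ^ l) y"
      using a True by (auto simp: y)
    ultimately have "2 ^ l dvd x \<or> 2 ^ l dvd y"
      by (metis coprime_dvd_mult_left_iff coprime_dvd_mult_right_iff)
    then show ?thesis
      using True by (auto simp: Suc cong_iff_dvd_diff xy)
  qed simp
qed

lemma card_odd_sign_classes:
  assumes "\<beta> \<ge> 1"
  shows "card (sign_class (int (2 ^ \<beta>)) ` {c. odd c}) = (if \<beta> = 1 then 1 else 2 ^ (\<beta> - 2))"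
proof (cases "\<beta> = 1")
  case True
  have "sign_class 2 c = sign_class 2 1" if "odd c" for c
    using that by (simp add: sign_class_eq_iff cong_iff_dvd_diff)
  moreover have "odd (1 :: int)"
    by simp
  ultimately have "sign_class 2 ` {c. odd c} = {sign_class 2 1}"
    by blast
  then show ?thesis
    using True by simp
next
  case False
  \<comment> \<open>every odd number is \<open>1\<close> or \<open>-1\<close> modulo \<open>4\<close>\<close>
  have "{c. odd c} = {c :: int. \<exists>r\<in>{1}. [c = r] (mod int 4) \<or> [c = - r] (mod int 4)}"
    by (auto simp: cong_def) presburger+
  moreover have "2 + (\<beta> - 2) = \<beta>"
    using assms False by simp
  then have "int (2 ^ \<beta>) = int (4 * 2 ^ (\<beta> - 2))"
    using power_add[of "2::nat" 2 "\<beta> - 2"] by simp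
  moreover have "\<not> [1 = - 1 :: int] (mod int 4)"
    by (simp add: cong_def)
  ultimately show ?thesis
    using False card_sign_classes[of "2 ^ (\<beta> - 2)" 4 "{1}"] by simp
qed

lemma card_unit_sign_classes:
  assumes p: "prime p" "p \<noteq> 2" and "\<beta> \<ge> 1"
  shows "card (sign_class (int (p ^ \<beta>)) ` {c. \<not> int p dvd c}) = (p - 1) * p ^ (\<beta> - 1) div 2"
proof -
  have "odd p" "p > 2"
    using p prime_odd_nat prime_ge_2_nat[of p] by force+
  then obtain h where h: "p = 2 * h + 1"
    by (auto elim: oddE)
  let ?R = "{1..int h}"
  have "{c. \<not> int p dvd c} = {c. \<exists>r\<in>?R. [c = r] (mod int p) \<or> [c = - r] (mod int p)}"
  proof (intro equalityI subsetI)
    fix c assume "c \<in> {c. \<not> int p dvd c}"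
    then have r: "0 < c mod int p" "c mod int p < int p"
      using \<open>p > 2\<close> pos_mod_sign[of "int p" c] pos_mod_bound[of "int p" c]
      by (auto simp: dvd_eq_mod_eq_0 order_less_le)
    show "c \<in> {c. \<exists>r\<in>?R. [c = r] (mod int p) \<or> [c = - r] (mod int p)}"
    proof (cases "c mod int p \<le> int h")
      case True
      then show ?thesis
        using r by (auto intro!: bexI[of _ "c mod int p"] simp: cong_def)
    next
      case False
      then have "[c = - (int p - c mod int p)] (mod int p)"
        by (simp add: cong_def mod_diff_eq)
      moreover have "int p - c mod int p \<in> ?R"
        unfolding atLeastAtMost_iff using r False h by linarith
      ultimately show ?thesis
        by blast
    qed
  next
    fix c assume "c \<in> {c. \<exists>r\<in>?R. [c = r] (mod int p) \<or> [c = - r] (mod int p)}"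
    then obtain r where r: "1 \<le> r" "r \<le> int h" "[c = r] (mod int p) \<or> [c = - r] (mod int p)"
      by auto
    have "\<not> int p dvd r"
      using zdvd_imp_le[of "int p" r] r h by auto
    then show "c \<in> {c. \<not> int p dvd c}"
      using r(3) cong_dvd_iff by fastforce
  qed
  moreover have "p * p ^ (\<beta> - 1) = p ^ \<beta>"
    using assms(3) by (simp flip: power_Suc)
  moreover have "card (sign_class (int (p * p ^ (\<beta> - 1))) `
      {c. \<exists>r\<in>?R. [c = r] (mod int p) \<or> [c = - r] (mod int p)}) = card ?R * p ^ (\<beta> - 1)"
  proof (rule card_sign_classes)
    show "r = r'" if "r \<in> ?R" "r' \<in> ?R" "[r = r'] (mod int p)" for r r'
      using that h by (simp add: cong_def)
    show "\<not> [r = - r'] (mod int p)" if "r \<in> ?R" "r' \<in> ?R" for r r'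
      using that zdvd_imp_le[of "int p" "r + r'"] h by (auto simp: cong_iff_dvd_diff)
  qed (use \<open>p > 2\<close> in simp_all)
  ultimately show ?thesis
    by (simp add: h)
qed

section \<open>The local conditions\<close>

definition locally_admissible :: "nat \<Rightarrow> nat \<Rightarrow> nat \<Rightarrow> nat \<Rightarrow> int \<Rightarrow> bool"
  where "locally_admissible t n p \<beta> c \<longleftrightarrow> \<not> int p dvd c \<and> int p ^ (2 * \<beta>) dvd int n + int t * c\<^sup>2"

text \<open>
  Fractions in the localization can be cleared, since denominators prime to \<open>p\<close> are invertible modulo
  powers of \<open>p\<close>.
\<close>

lemma is_square_mod_power_iff:
  assumes p: "prime p" and M: "\<not> p dvd M"
  shows "is_square_mod_power p k (- of_nat (p ^ \<alpha> * N) / of_nat (p ^ \<alpha> * M)) \<longleftrightarrow>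
    (\<exists>c. int p ^ k dvd int N + int M * c\<^sup>2)"
proof -
  have nz: "p \<noteq> 0" "M \<noteq> 0"
    using prime_gt_0_nat[OF p] M by (simp, metis dvd_0_right)
  have u: "- of_nat (p ^ \<alpha> * N) / of_nat (p ^ \<alpha> * M) = (- of_nat N / of_nat M :: rat)"
    using nz by simp
  have M': "\<not> int p dvd int M"
    using M by simp
  show ?thesis
    unfolding u
  proof
    assume "\<exists>c. int p ^ k dvd int N + int M * c\<^sup>2"
    then obtain c e where "int N + int M * c\<^sup>2 = int p ^ k * e"
      by (auto elim: dvdE)
    then have "of_int (int N + int M * c\<^sup>2) = (of_int (int p ^ k * e) :: rat)"
      by (simp only:)
    then have eq: "of_nat N + of_nat M * (of_int c)\<^sup>2 = (of_nat p ^ k * of_int e :: rat)"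
      by simp
    have "of_int c / of_int 1 \<in> localization_at p"
      using p unfolding localization_at_def by (metis (mono_tags, lifting) mem_Collect_eq int_dvd_int_iff
          not_prime_unit of_nat_1)
    then have z: "of_int c \<in> localization_at p"
      by simp
    have w: "of_int (- e) / of_int (int M) \<in> localization_at p"
      using M' unfolding localization_at_def by blast
    have "- of_nat N / of_nat M - (of_int c)\<^sup>2 = - ((of_nat N + of_nat M * (of_int c)\<^sup>2) / of_nat M :: rat)"
      using nz by (simp add: field_simps)
    also have "\<dots> = of_nat p ^ k * (of_int (- e) / of_int (int M))"
      by (simp add: eq)
    finally show "is_square_mod_power p k (- of_nat N / of_nat M)"
      using z w unfolding is_square_mod_power_def by blast
  next
    assume "is_square_mod_power p k (- of_nat N / of_nat M)"
    then obtain a b e f where b: "\<not> int p dvd b" and f: "\<not> int p dvd f"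
      and eq: "- of_nat N / of_nat M - (of_int a / of_int b)\<^sup>2 = (of_nat p ^ k * (of_int e / of_int f) :: rat)"
      unfolding is_square_mod_power_def localization_at_def by blast
    have "b \<noteq> 0" "f \<noteq> 0"
      using b f by auto
    then have "- ((of_nat N * (of_int b)\<^sup>2 + of_nat M * (of_int a)\<^sup>2) * of_int f) =
        (of_nat p ^ k * (of_int e * (of_nat M * (of_int b)\<^sup>2)) :: rat)"
      using eq nz by (simp add: field_simps power2_eq_square)
    then have "of_int (- ((int N * b\<^sup>2 + int M * a\<^sup>2) * f)) = (of_int (int p ^ k * (e * (int M * b\<^sup>2))) :: rat)"
      by simp
    then have "- ((int N * b\<^sup>2 + int M * a\<^sup>2) * f) = int p ^ k * (e * (int M * b\<^sup>2))"
      by (simp only: of_int_eq_iff)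
    then have "int p ^ k dvd (int N * b\<^sup>2 + int M * a\<^sup>2) * f"
      by (metis dvd_minus_iff dvd_triv_left)
    moreover have "coprime (int p ^ k) x" if "\<not> int p dvd x" for x
      using p that by (simp add: prime_imp_coprime)
    note cop = this
    ultimately have dvd: "int p ^ k dvd int N * b\<^sup>2 + int M * a\<^sup>2"
      using f coprime_dvd_mult_left_iff by blast
    obtain b' where b': "[b * b' = 1] (mod int p ^ k)"
      using cop[OF b] cong_solve_coprime_int[of b "int p ^ k"] by (auto simp: coprime_commute)
    have "[int N * 1 + int M * (a * b')\<^sup>2 = int N * (b * b')\<^sup>2 + int M * (a * b')\<^sup>2] (mod int p ^ k)"
      using cong_pow[OF b', of 2] by (intro cong_add cong_mult cong_refl) (simp add: cong_sym_eq)
    moreover have "int N * (b * b')\<^sup>2 + int M * (a * b')\<^sup>2 = (int N * b\<^sup>2 + int M * a\<^sup>2) * b'\<^sup>2"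
      by (simp add: algebra_simps power_mult_distrib)
    ultimately have "int p ^ k dvd int N + int M * (a * b')\<^sup>2"
      using dvd by (simp add: cong_dvd_iff)
    then show "\<exists>c. int p ^ k dvd int N + int M * c\<^sup>2" ..
  qed
qed

lemma local_condition_iff:
  "local_condition t n g p \<longleftrightarrow>
    2 * multiplicity p g \<le> min (multiplicity p t) (multiplicity p n) \<or>
    multiplicity p t = multiplicity p n \<and>
      is_square_mod_power p (2 * multiplicity p g - multiplicity p t) (- of_nat n / of_nat t)"
proof -
  have "real b \<le> real a / 2 \<longleftrightarrow> 2 * b \<le> a" for a b
    by linarith
  then show ?thesis
    by (auto simp: local_condition_def Let_def)
qed

lemma local_count_eq:
  "local_count t n g p =
    (let \<alpha> = min (multiplicity p t) (multiplicity p n); \<beta> = multiplicity p g in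
      if p = 2 then
        (if \<beta> = 1 then 1 else if 2 * \<beta> \<le> \<alpha> + 2 then 2 ^ (\<beta> - 2) else 2 ^ (\<alpha> + 1 - \<beta>))
      else (if 2 * \<beta> \<le> \<alpha> then (p - 1) * p ^ (\<beta> - 1) div 2 else p ^ (\<alpha> - \<beta>)))"
proof -
  have "real b \<le> real a / 2 \<longleftrightarrow> 2 * b \<le> a" "real b \<le> real a / 2 + 1 \<longleftrightarrow> 2 * b \<le> a + 2" for a b
    by linarith+
  then show ?thesis
    unfolding local_count_def Let_def by simp
qed

text \<open>
  Let \<open>a\<close> and \<open>b\<close> be the valuations of \<open>t\<close> and \<open>n\<close>. If \<open>p\<^sup>2\<^sup>\<beta>\<close> divides both, the condition is void. Otherwise
  both terms of \<open>n + t c\<^sup>2\<close> must have the same valuation, and dividing by \<open>p\<^sup>a\<close> leaves a quadratic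
  congruence, whose solutions are described relative to one of them, \<open>c0\<close>.
\<close>

lemma locally_admissible_cases:
  fixes t n p \<beta> :: nat
  assumes p: "prime p" and pos: "t > 0" "n > 0"
  defines "a \<equiv> multiplicity p t" and "b \<equiv> multiplicity p n"
  obtains (divisible) "2 * \<beta> \<le> min a b" "\<And>c. locally_admissible t n p \<beta> c \<longleftrightarrow> \<not> int p dvd c"
  | (unequal) "min a b < 2 * \<beta>" "a \<noteq> b" "\<And>c. \<not> locally_admissible t n p \<beta> c"
  | (insoluble) "min a b < 2 * \<beta>" "a = b" "\<And>c. \<not> locally_admissible t n p \<beta> c"
      "\<not> is_square_mod_power p (2 * \<beta> - a) (- of_nat n / of_nat t)"
  | (soluble) c0 where "min a b < 2 * \<beta>" "a = b" "\<not> int p dvd c0"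
      "\<And>c. locally_admissible t n p \<beta> c \<longleftrightarrow> \<not> int p dvd c \<and> int p ^ (2 * \<beta> - a) dvd c\<^sup>2 - c0\<^sup>2"
      "is_square_mod_power p (2 * \<beta> - a) (- of_nat n / of_nat t)"
proof -
  have pp: "prime (int p)"
    using p by simp
  have not_unit: "\<not> is_unit p"
    using p by auto
  obtain M where M: "t = p ^ a * M" "\<not> p dvd M"
    using multiplicity_decompose'[of t p] pos not_unit unfolding a_def by auto
  obtain N where N: "n = p ^ b * N" "\<not> p dvd N"
    using multiplicity_decompose'[of n p] pos not_unit unfolding b_def by auto
  have MN: "\<not> int p dvd int M" "\<not> int p dvd int N"
    using M N by simp_all
  have tn: "int t = int p ^ a * int M" "int n = int p ^ b * int N"
    unfolding M(1) N(1) by simp_all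
  consider "2 * \<beta> \<le> min a b" | "min a b < 2 * \<beta>" "a < b" | "min a b < 2 * \<beta>" "b < a"
    | "min a b < 2 * \<beta>" "a = b"
    by linarith
  then show thesis
  proof cases
    case 1
    then have "int p ^ (2 * \<beta>) dvd int n" "int p ^ (2 * \<beta>) dvd int t"
      unfolding tn by (auto intro: dvd_mult2 le_imp_power_dvd)
    then show thesis
      using divisible 1 by (simp add: locally_admissible_def)
  next
    case 2
    have "\<not> locally_admissible t n p \<beta> c" for c
    proof
      assume c: "locally_admissible t n p \<beta> c"
      have "int p ^ Suc a dvd int p ^ (2 * \<beta>)" "int p ^ Suc a dvd int p ^ b"
        using 2 by (auto intro!: le_imp_power_dvd simp del: power_Suc)
      moreover from this have "int p ^ Suc a dvd int n"
        unfolding tn by (intro dvd_mult2)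
      ultimately have "int p ^ Suc a dvd int t * c\<^sup>2"
        using c unfolding locally_admissible_def by (metis dvd_add_right_iff dvd_trans)
      then have "int p dvd int M * c\<^sup>2"
        using prime_gt_0_nat[OF p] by (simp add: tn mult.assoc mult.commute[of "int p"])
      then show False
        using MN c pp by (auto simp: prime_dvd_mult_iff prime_dvd_power_iff locally_admissible_def)
    qed
    then show thesis
      using unequal 2 by simp
  next
    case 3
    have "\<not> locally_admissible t n p \<beta> c" for c
    proof
      assume c: "locally_admissible t n p \<beta> c"
      have "int p ^ Suc b dvd int p ^ (2 * \<beta>)" "int p ^ Suc b dvd int p ^ a"
        using 3 by (auto intro!: le_imp_power_dvd simp del: power_Suc)
      moreover from this have "int p ^ Suc b dvd int t * c\<^sup>2"
        unfolding tn by (intro dvd_mult2)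
      ultimately have "int p ^ Suc b dvd int n"
        using c unfolding locally_admissible_def by (metis dvd_add_left_iff dvd_trans)
      then show False
        using MN prime_gt_0_nat[OF p] by (simp add: tn mult.commute[of "int p"])
    qed
    then show thesis
      using unequal 3 by simp
  next
    case 4
    define k where "k = 2 * \<beta> - a"
    have k: "k > 0" "a + k = 2 * \<beta>"
      using 4 by (simp_all add: k_def)
    have sq: "is_square_mod_power p k (- of_nat n / of_nat t) \<longleftrightarrow> (\<exists>c. int p ^ k dvd int N + int M * c\<^sup>2)"
      using is_square_mod_power_iff[OF p M(2), of k a N] M(1) N(1) 4(2) by simp
    have adm: "locally_admissible t n p \<beta> c \<longleftrightarrow> \<not> int p dvd c \<and> int p ^ k dvd int N + int M * c\<^sup>2" for c
    proof -
      have "int n + int t * c\<^sup>2 = int p ^ a * (int N + int M * c\<^sup>2)"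
        by (simp add: tn 4(2) algebra_simps)
      then show ?thesis
        using prime_gt_0_nat[OF p] by (simp add: locally_admissible_def power_add flip: k(2))
    qed
    show thesis
    proof (cases "\<exists>c. int p ^ k dvd int N + int M * c\<^sup>2")
      case False
      then show thesis
        using insoluble 4 adm sq unfolding k_def by blast
    next
      case True
      then obtain c0 where c0: "int p ^ k dvd int N + int M * c0\<^sup>2"
        by blast
      have "int p dvd int p ^ k"
        using k(1) by (simp add: dvd_power)
      then have "int p dvd int N + int M * c0\<^sup>2"
        using c0 dvd_trans by blast
      then have unit: "\<not> int p dvd c0"
        using MN(2) by (metis dvd_add_left_iff dvd_mult dvd_power zero_less_numeral dvd_trans)
      have "int p ^ k dvd int N + int M * c\<^sup>2 \<longleftrightarrow> int p ^ k dvd c\<^sup>2 - c0\<^sup>2" for c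
      proof -
        have "int N + int M * c\<^sup>2 = (int N + int M * c0\<^sup>2) + int M * (c\<^sup>2 - c0\<^sup>2)"
          by (simp add: algebra_simps)
        then have "int p ^ k dvd int N + int M * c\<^sup>2 \<longleftrightarrow> int p ^ k dvd int M * (c\<^sup>2 - c0\<^sup>2)"
          using c0 by (simp only: dvd_add_right_iff)
        moreover have "coprime (int p ^ k) (int M)"
          using MN(1) pp by (simp add: prime_imp_coprime)
        ultimately show ?thesis
          by (simp add: coprime_dvd_mult_right_iff)
      qed
      then show thesis
        using soluble[of c0] 4 unit adm sq True unfolding k_def by blast
    qed
  qed
qed

lemma locally_admissible_iff_local_condition:
  assumes p: "prime p" and pos: "t > 0" "n > 0"
  shows "(\<exists>c. locally_admissible t n p (multiplicity p g) c) \<longleftrightarrow> local_condition t n g p"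
  using p pos
proof (cases rule: locally_admissible_cases[where \<beta> = "multiplicity p g"])
    case divisible
    have "\<not> int p dvd 1"
      using p by auto
    then have "locally_admissible t n p (multiplicity p g) 1"
      by (simp only: divisible(2) not_False_eq_True)
    then show ?thesis
      using divisible(1) by (auto simp: local_condition_iff)
qed (auto simp: local_condition_iff)

text \<open>
  In the soluble case put \<open>k = 2\<beta> - \<alpha>\<close>. For odd \<open>p\<close> the solutions are the residues equal to \<open>c0\<close> up to sign
  modulo \<open>p\<^sup>k\<close>. For \<open>p = 2\<close> they are all odd numbers if \<open>k \<le> 2\<close>, because odd squares agree modulo \<open>4\<close>, and
  otherwise the residues equal to \<open>c0\<close> up to sign modulo \<open>2\<close> to the power \<open>k - 1\<close>. These are the thresholds
  in the formula for the count.
\<close>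

lemma card_locally_admissible:
  fixes t n p g :: nat
  assumes p: "prime p" and pos: "t > 0" "n > 0" "g > 0" and g: "p dvd g" "g dvd gcd (2 * t) (2 * n)"
    and cond: "local_condition t n g p"
  shows "card (sign_class (int (p ^ multiplicity p g)) ` {c. locally_admissible t n p (multiplicity p g) c}) =
    local_count t n g p"
proof -
  define a b \<beta> where "a = multiplicity p t" and "b = multiplicity p n" and "\<beta> = multiplicity p g"
  have \<beta>: "\<beta> \<ge> 1"
    using p pos g unfolding \<beta>_def by (simp add: Suc_le_eq prime_multiplicity_gt_zero_iff)
  have le: "\<beta> \<le> a + (if p = 2 then 1 else 0)"
  proof -
    have "\<beta> \<le> multiplicity p (2 * t)"
      unfolding \<beta>_def using g pos by (intro dvd_imp_multiplicity_le) auto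
    also have "\<dots> = multiplicity p 2 + a"
      using p pos by (simp add: a_def prime_elem_multiplicity_mult_distrib)
    also have "multiplicity p 2 = (if p = 2 then 1 else 0)"
      using p by (auto simp: primes_dvd_imp_eq intro: not_dvd_imp_multiplicity_0)
    finally show ?thesis
      by simp
  qed
  have count: "local_count t n g p =
      (if p = 2 then
        (if \<beta> = 1 then 1 else if 2 * \<beta> \<le> min a b + 2 then 2 ^ (\<beta> - 2) else 2 ^ (min a b + 1 - \<beta>))
      else (if 2 * \<beta> \<le> min a b then (p - 1) * p ^ (\<beta> - 1) div 2 else p ^ (min a b - \<beta>)))"
    unfolding local_count_eq Let_def a_def b_def \<beta>_def ..
  have "card (sign_class (int (p ^ \<beta>)) ` {c. locally_admissible t n p \<beta> c}) = local_count t n g p"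
    using p pos(1,2)
  proof (cases rule: locally_admissible_cases[where \<beta> = \<beta>])
    case divisible
    then have le: "2 * \<beta> \<le> min a b"
      by (simp add: a_def b_def)
    show ?thesis
    proof (cases "p = 2")
      case True
      have "{c. locally_admissible t n p \<beta> c} = {c. odd c}"
        using divisible(2) True by simp
      moreover have "2 * \<beta> \<le> min a b + 2"
        using le by linarith
      ultimately show ?thesis
        using card_odd_sign_classes[OF \<beta>] True count by simp
    next
      case False
      then show ?thesis
        using card_unit_sign_classes[OF p _ \<beta>] le divisible(2) count by simp
    qed
  next
    case unequal
    then show ?thesis
      using cond by (auto simp: local_condition_iff min_less_iff_disj \<beta>_def)
  next
    case insoluble
    then show ?thesis
      using cond by (auto simp: local_condition_iff min_less_iff_disj \<beta>_def)
  next
    case (soluble c0)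
    define k where "k = 2 * \<beta> - a"
    have k: "a + k = 2 * \<beta>" "k \<ge> 1" and ab: "b = a"
      using soluble by (simp_all add: k_def a_def b_def)
    have adm: "locally_admissible t n p \<beta> c \<longleftrightarrow> \<not> int p dvd c \<and> int p ^ k dvd c\<^sup>2 - c0\<^sup>2" for c
      using soluble by (simp add: k_def a_def)
    \<comment> \<open>the hypotheses on \<open>j\<close> make \<open>c0\<close> and \<open>- c0\<close> distinct modulo \<open>p\<^sup>j\<close>\<close>
    have roots: "card (sign_class (int (p ^ \<beta>)) ` {c. locally_admissible t n p \<beta> c}) = p ^ (\<beta> - j)"
      if j: "k = j + (if p = 2 then 1 else 0)" "j \<le> \<beta>" "j \<ge> 1" "p = 2 \<Longrightarrow> j \<ge> 2" for j
    proof -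
      have dj: "int p dvd int p ^ j"
        using j(3) by (simp add: dvd_power)
      have "locally_admissible t n p \<beta> c \<longleftrightarrow> [c = c0] (mod int (p ^ j)) \<or> [c = - c0] (mod int (p ^ j))" for c
      proof
        assume "locally_admissible t n p \<beta> c"
        then show "[c = c0] (mod int (p ^ j)) \<or> [c = - c0] (mod int (p ^ j))"
          using prime_power_dvd_square_diff[OF p soluble(3), of c j] j(1) by (simp add: adm)
      next
        assume c: "[c = c0] (mod int (p ^ j)) \<or> [c = - c0] (mod int (p ^ j))"
        then have "[c = c0] (mod int p) \<or> [c = - c0] (mod int p)"
          using dj by (auto intro: cong_dvd_modulus)
        then have unit: "\<not> int p dvd c"
          using soluble(3) cong_dvd_iff[of c c0 "int p"] cong_dvd_iff[of c "- c0" "int p"] by auto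
        have sq: "c\<^sup>2 - c0\<^sup>2 = (c - c0) * (c + c0)"
          by (simp add: power2_eq_square algebra_simps)
        have dvd: "int p ^ j dvd c - c0 \<or> int p ^ j dvd c + c0"
          using c by (simp add: cong_iff_dvd_diff)
        have "int p ^ k dvd c\<^sup>2 - c0\<^sup>2"
        proof (cases "p = 2")
          case False
          then show ?thesis
            using dvd j(1) by (auto simp: sq)
        next
          case True
          then have "even (c - c0)" "even (c + c0)"
            using unit soluble(3) by simp_all
          then have "2 ^ j * 2 dvd (c - c0) * (c + c0) \<or> 2 * 2 ^ j dvd (c - c0) * (c + c0)"
            using dvd True mult_dvd_mono by (metis of_nat_numeral)
          then show ?thesis
            using True j(1) by (simp add: sq mult.commute)
        qed
        with unit show "locally_admissible t n p \<beta> c"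
          by (simp add: adm)
      qed
      then have eq: "{c. locally_admissible t n p \<beta> c} =
          {c. \<exists>r\<in>{c0}. [c = r] (mod int (p ^ j)) \<or> [c = - r] (mod int (p ^ j))}"
        by simp
      have gt: "p ^ j > 2"
      proof (cases "p = 2")
        case True
        then have "(2::nat) ^ 2 \<le> p ^ j"
          using j(4) by (simp only:) (rule power_increasing, auto)
        then show ?thesis
          by simp
      next
        case False
        then have "2 < p"
          using prime_ge_2_nat[OF p] by simp
        also have "p ^ 1 \<le> p ^ j"
          using j(3) \<open>2 < p\<close> by (intro power_increasing) auto
        finally show ?thesis
          by simp
      qed
      have "\<not> [c0 = - c0] (mod int (p ^ j))"
      proof
        assume "[c0 = - c0] (mod int (p ^ j))"
        then have "int p ^ j dvd 2 * c0"
          by (simp add: cong_iff_dvd_diff)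
        moreover have "coprime (int p ^ j) c0"
          using soluble(3) p by (simp add: prime_imp_coprime)
        ultimately have "int (p ^ j) dvd 2"
          by (simp add: coprime_dvd_mult_left_iff)
        then have "p ^ j dvd 2"
          using int_dvd_int_iff[of "p ^ j" 2] by simp
        then show False
          using gt dvd_imp_le[of "p ^ j" 2] by simp
      qed
      moreover have "p ^ j * p ^ (\<beta> - j) = p ^ \<beta>"
        using j(2) by (simp flip: power_add)
      ultimately show ?thesis
        unfolding eq using card_sign_classes[of "p ^ (\<beta> - j)" "p ^ j" "{c0}"] prime_gt_0_nat[OF p] by simp
    qed
    consider "p \<noteq> 2" | "p = 2" "2 * \<beta> \<le> a + 2" | "p = 2" "a + 2 < 2 * \<beta>"
      by linarith
    then show ?thesis
    proof cases
      case 1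
      then have "\<beta> - k = a - \<beta>" "k \<le> \<beta>"
        using k le by simp_all
      then show ?thesis
        using roots[of k] 1 k by (simp add: count ab)
    next
      case 2
      have "locally_admissible t n p \<beta> c \<longleftrightarrow> odd c" for c
      proof -
        have "int p ^ k dvd c\<^sup>2 - c0\<^sup>2" if "odd c"
        proof -
          have "odd c0"
            using soluble(3) 2(1) by simp
          then obtain y where y: "c0 = 2 * y + 1"
            by (rule oddE)
          obtain x where "c = 2 * x + 1"
            using \<open>odd c\<close> by (rule oddE)
          with y have "c\<^sup>2 - c0\<^sup>2 = 2 ^ 2 * (x * (x + 1) - y * (y + 1))"
            by (simp add: power2_eq_square algebra_simps)
          moreover have "(2::int) ^ k dvd 2 ^ 2"
            using k(1) 2(2) by (intro le_imp_power_dvd) simp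
          ultimately show ?thesis
            using 2(1) by (simp only: of_nat_numeral) (rule dvd_mult2)
        qed
        then show ?thesis
          unfolding adm using 2(1) by auto
      qed
      then have "{c. locally_admissible t n p \<beta> c} = {c. odd c}"
        by blast
      then show ?thesis
        using card_odd_sign_classes[OF \<beta>] 2 count by (simp add: ab)
    next
      case 3
      have "\<beta> - (k - 1) = a + 1 - \<beta>" "k - 1 \<le> \<beta>" "k - 1 \<ge> 2" "\<beta> \<noteq> 1" "\<not> 2 * \<beta> \<le> a + 2"
        using k le 3 by simp_all
      then show ?thesis
        using roots[of "k - 1"] 3(1) count by (simp add: ab)
    qed
  qed
  then show ?thesis
    by (simp only: \<beta>_def)
qed

section \<open>From prime powers to the divisibility\<close>

lemma coprime_distinct_prime_powers:
  fixes p q g :: nat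
  assumes "p \<in> prime_factors g" "q \<in> prime_factors g" "p \<noteq> q"
  shows "coprime (p ^ i) (q ^ j)"
  using assms by (auto intro!: primes_coprime)

lemma cong_iff_cong_prime_powers:
  fixes g :: nat and x y :: int
  assumes "g > 0"
  shows "[x = y] (mod int g ^ e) \<longleftrightarrow>
    (\<forall>p\<in>prime_factors g. [x = y] (mod int p ^ (multiplicity p g * e)))"
proof -
  have "g ^ e = (\<Prod>p\<in>prime_factors g. p ^ multiplicity p g) ^ e"
    using assms by (simp add: prime_factorization_nat[symmetric])
  then have g: "int g ^ e = (\<Prod>p\<in>prime_factors g. int p ^ (multiplicity p g * e))"
    by (simp add: power_mult prod_power_distrib flip: of_nat_power of_nat_prod)
  show ?thesis
  proof
    assume "[x = y] (mod int g ^ e)"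
    then show "\<forall>p\<in>prime_factors g. [x = y] (mod int p ^ (multiplicity p g * e))"
      unfolding g by (auto intro: cong_dvd_modulus dvd_prodI)
  next
    assume "\<forall>p\<in>prime_factors g. [x = y] (mod int p ^ (multiplicity p g * e))"
    then show "[x = y] (mod int g ^ e)"
      unfolding g
      by (rule cong_cong_prod_coprime)
        (use coprime_distinct_prime_powers in \<open>simp flip: of_nat_power\<close>)
  qed
qed

lemma coprime_iff_prime_factors:
  fixes g :: nat and c :: int
  assumes "g > 0"
  shows "coprime c (int g) \<longleftrightarrow> (\<forall>p\<in>prime_factors g. \<not> int p dvd c)"
proof
  assume "coprime c (int g)"
  moreover have "\<not> is_unit (int p)" "int p dvd int g" if "p \<in> prime_factors g" for p
    using that prime_gt_1_nat[of p] by (auto simp: in_prime_factors_iff)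
  ultimately show "\<forall>p\<in>prime_factors g. \<not> int p dvd c"
    using coprime_common_divisor by blast
next
  assume *: "\<forall>p\<in>prime_factors g. \<not> int p dvd c"
  have "int g = int (\<Prod>p\<in>prime_factors g. p ^ multiplicity p g)"
    using prime_factorization_nat[OF assms] by (rule arg_cong)
  also have "\<dots> = (\<Prod>p\<in>prime_factors g. int p ^ multiplicity p g)"
    by simp
  finally have "int g = (\<Prod>p\<in>prime_factors g. int p ^ multiplicity p g)" .
  moreover have "coprime c (int p ^ multiplicity p g)" if "p \<in> prime_factors g" for p
    using * that by (simp add: coprime_commute[of c] prime_imp_coprime in_prime_factors_iff)
  ultimately show "coprime c (int g)"
    by (simp add: prod_coprime_right)
qed

lemma chinese_remainder_prime_factors:
  fixes g :: nat and f :: "nat \<Rightarrow> int"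
  assumes "g > 0"
  obtains c where "\<And>p. p \<in> prime_factors g \<Longrightarrow> [c = f p] (mod int (p ^ multiplicity p g))"
proof -
  have "\<forall>p\<in>prime_factors g. \<forall>q\<in>prime_factors g. p \<noteq> q \<longrightarrow>
      coprime (p ^ multiplicity p g) (q ^ multiplicity q g)"
    using coprime_distinct_prime_powers by blast
  then obtain x where x: "\<forall>p\<in>prime_factors g.
      [x = nat (f p mod int (p ^ multiplicity p g))] (mod p ^ multiplicity p g)"
    using chinese_remainder_nat[of "prime_factors g" "\<lambda>p. p ^ multiplicity p g"
        "\<lambda>p. nat (f p mod int (p ^ multiplicity p g))"] by auto
  show thesis
  proof
    fix p assume p: "p \<in> prime_factors g"
    let ?q = "p ^ multiplicity p g"
    have "?q > 0"
      using p by (simp add: in_prime_factors_iff prime_gt_0_nat)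
    have "[int x = int (nat (f p mod int ?q))] (mod int ?q)"
      using x p by (simp only: cong_int_iff)
    also have "int (nat (f p mod int ?q)) = f p mod int ?q"
      using \<open>?q > 0\<close> by (simp del: of_nat_power)
    finally show "[int x = f p] (mod int ?q)"
      by simp
  qed
qed

text \<open>
  Replacing \<open>c\<close> by \<open>c + q k\<close> with \<open>q = p\<^sup>\<beta>\<close> changes \<open>t c\<^sup>2\<close> by \<open>2 t q c k + t q\<^sup>2 k\<^sup>2\<close>, and \<open>q\<close> divides \<open>2 t\<close>. So the
  condition modulo \<open>q\<^sup>2\<close> depends only on \<open>c\<close> modulo \<open>q\<close>.
\<close>

lemma locally_admissible_cong:
  assumes c: "[c = c'] (mod int p ^ \<beta>)" and t: "p ^ \<beta> dvd 2 * t" and "\<beta> \<ge> 1"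
  shows "locally_admissible t n p \<beta> c \<longleftrightarrow> locally_admissible t n p \<beta> c'"
proof -
  obtain k where k: "c' = c + int p ^ \<beta> * k"
    using c unfolding cong_iff_lin by blast
  obtain s where s: "2 * int t = int p ^ \<beta> * s"
    using t by (metis dvdE of_nat_mult of_nat_numeral of_nat_power)
  have q2: "int p ^ (2 * \<beta>) = int p ^ \<beta> * int p ^ \<beta>"
    by (simp add: mult_2 power_add)
  have "int t * c'\<^sup>2 = int t * c\<^sup>2 + (2 * int t) * int p ^ \<beta> * (c * k) + int p ^ \<beta> * int p ^ \<beta> * (int t * k\<^sup>2)"
    by (simp add: k power2_eq_square algebra_simps)
  also have "\<dots> = int t * c\<^sup>2 + int p ^ (2 * \<beta>) * (s * (c * k) + int t * k\<^sup>2)"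
    unfolding s q2 by (simp add: algebra_simps)
  finally have "int n + int t * c'\<^sup>2 = (int n + int t * c\<^sup>2) + int p ^ (2 * \<beta>) * (s * (c * k) + int t * k\<^sup>2)"
    by simp
  then have "int p ^ (2 * \<beta>) dvd int n + int t * c'\<^sup>2 \<longleftrightarrow> int p ^ (2 * \<beta>) dvd int n + int t * c\<^sup>2"
    by (simp only: dvd_add_left_iff dvd_triv_left)
  moreover have "int p dvd int p ^ \<beta>"
    using assms(3) by (simp add: dvd_power)
  then have "int p dvd c \<longleftrightarrow> int p dvd c'"
    using c cong_dvd_iff cong_dvd_modulus by blast
  ultimately show ?thesis
    by (simp add: locally_admissible_def)
qed

lemma card_image_eq_card_image:
  assumes "\<And>c c'. c \<in> C \<Longrightarrow> c' \<in> C \<Longrightarrow> h c = h c' \<longleftrightarrow> f c = f c'"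
  shows "card (h ` C) = card (f ` C)"
proof (rule bij_betw_same_card)
  have inv: "inv_into C h (h c) \<in> C" "h (inv_into C h (h c)) = h c" if "c \<in> C" for c
    using that by (simp_all add: inv_into_into f_inv_into_f)
  then have "f (inv_into C h (h c)) = f c" if "c \<in> C" for c
    using that assms by blast
  then show "bij_betw (\<lambda>X. f (inv_into C h X)) (h ` C) (f ` C)"
    unfolding bij_betw_def inj_on_def using assms by (auto simp: image_image)
qed

lemma coprime_factorization:
  fixes t :: nat
  assumes "t > 0"
  obtains P Q where "t = P * Q" "coprime P Q" "\<And>p. prime p \<Longrightarrow> p dvd P \<longleftrightarrow> p dvd t \<and> p \<in> S"
proof -
  let ?m = "\<lambda>p. p ^ multiplicity p t"
  define P where "P = prod ?m (prime_factors t \<inter> S)"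
  define Q where "Q = prod ?m (prime_factors t - S)"
  have "t = prod ?m (prime_factors t)"
    using prime_factorization_nat[OF assms] .
  also have "\<dots> = P * Q"
    unfolding P_def Q_def using prod.Int_Diff[of "prime_factors t" ?m S] by simp
  finally have "t = P * Q" .
  moreover have "coprime P Q"
    unfolding P_def Q_def
    by (intro prod_coprime_left prod_coprime_right coprime_distinct_prime_powers[of _ t]) auto
  moreover have "p dvd P \<longleftrightarrow> p dvd t \<and> p \<in> S" if "prime p" for p
  proof
    assume "p dvd P"
    then have "\<exists>q\<in>prime_factors t \<inter> S. p dvd ?m q"
      using that unfolding P_def by (subst (asm) prime_dvd_prod_iff) auto
    then obtain q where "q \<in> prime_factors t \<inter> S" "p dvd ?m q" ..
    then have "p = q"
      using that prime_dvd_power[OF that \<open>p dvd ?m q\<close>] by (auto intro: primes_dvd_imp_eq)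
    then show "p dvd t \<and> p \<in> S"
      using \<open>q \<in> _\<close> by auto
  next
    assume p: "p dvd t \<and> p \<in> S"
    then have "p \<in> prime_factors t \<inter> S"
      using that assms by (simp add: in_prime_factors_iff)
    moreover have "p dvd ?m p"
      using p that assms by (simp add: dvd_power prime_multiplicity_gt_zero_iff)
    ultimately show "p dvd P"
      unfolding P_def by (meson dvd_prodI dvd_trans finite_Int finite_set_mset)
  qed
  ultimately show thesis
    using that by blast
qed

section \<open>Orbits and signs\<close>

context eichler_lattice
begin

lemma admissible_iff_locally_admissible:
  assumes "t = int t'" "g > 0"
  shows "admissible (int g) (int n) c \<longleftrightarrow>
    (\<forall>p\<in>prime_factors g. locally_admissible t' n p (multiplicity p g) c)"
proof -
  have "(int g)\<^sup>2 dvd int n + t * c\<^sup>2 \<longleftrightarrow>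
      (\<forall>p\<in>prime_factors g. int p ^ (2 * multiplicity p g) dvd int n + int t' * c\<^sup>2)"
    using cong_iff_cong_prime_powers[OF assms(2), of "int n + t * c\<^sup>2" 0 2]
    by (simp add: assms(1) cong_0_iff mult.commute)
  then show ?thesis
    unfolding admissible_def locally_admissible_def coprime_iff_prime_factors[OF assms(2)] by blast
qed

text \<open>
  For the converse, let \<open>P\<close> collect the part of \<open>t\<close> at those primes where the sign is \<open>-1\<close> and \<open>Q\<close> the
  rest. The multiplier of the corresponding Atkin--Lehner isometry has the prescribed sign at every prime
  dividing \<open>\<gamma>\<close>, because \<open>p\<^sup>\<beta>\<close> divides \<open>2 P Q\<close> and is coprime to one of the factors \<open>P\<close> and \<open>Q\<close>.
\<close>

lemma orbit_normal_form_iff: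
  assumes t: "t = int t'" and g: "g > 0" "g dvd 2 * t'"
    and c: "admissible (int g) (int n) c" and c': "admissible (int g) (int n) c'"
  shows "normal_form (int g) (int n) c' \<in> isometry_orbit \<Lambda> (normal_form (int g) (int n) c) \<longleftrightarrow>
    (\<forall>p\<in>prime_factors g.
      [c' = c] (mod int p ^ multiplicity p g) \<or> [c' = - c] (mod int p ^ multiplicity p g))"
    (is "?orbit \<longleftrightarrow> ?signs")
proof
  assume ?orbit
  then obtain \<phi> where iso: "is_isometry \<Lambda> \<Lambda> \<phi>"
    and \<phi>: "\<phi> (normal_form (int g) (int n) c) = normal_form (int g) (int n) c'"
    by (auto simp: in_isometry_orbit)
  obtain u where u: "[u\<^sup>2 = 1] (mod 4 * t)"
    and "[ell (\<phi> (normal_form (int g) (int n) c)) = u * c] (mod int g)"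
    using isometry_ell[OF iso] g(1) c unfolding admissible_def by (metis of_nat_0_less_iff)
  then have cong: "[c' = u * c] (mod int g)"
    by (simp add: \<phi>) (simp add: normal_form_def)
  show ?signs
  proof
    fix p assume "p \<in> prime_factors g"
    then have p: "prime p" "p dvd g"
      by auto
    let ?\<beta> = "multiplicity p g"
    have q: "p ^ ?\<beta> dvd g"
      by (rule multiplicity_dvd)
    then have "p ^ ?\<beta> dvd 2 * t'"
      using g(2) dvd_trans by blast
    then have q2t: "int p ^ ?\<beta> dvd 2 * t"
      unfolding t by (metis of_nat_dvd_iff of_nat_mult of_nat_numeral of_nat_power)
    have u4: "4 * t dvd u\<^sup>2 - 1\<^sup>2"
      using u by (simp add: cong_iff_dvd_diff)
    have "int p ^ (?\<beta> + (if p = 2 then 1 else 0)) dvd 4 * t"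
    proof (cases "p = 2")
      case True
      then show ?thesis
        using mult_dvd_mono[OF dvd_refl[of 2] q2t] by simp
    next
      case False
      then show ?thesis
        using dvd_mult[OF q2t, of 2] by simp
    qed
    then have dvd: "int p ^ (?\<beta> + (if p = 2 then 1 else 0)) dvd u\<^sup>2 - 1\<^sup>2"
      using u4 dvd_trans by blast
    have p1: "\<not> int p dvd 1"
      using prime_gt_1_nat[OF p(1)] by simp
    have "?\<beta> > 0"
      using p g(1) by (simp add: prime_multiplicity_gt_zero_iff)
    then have "int p dvd int p ^ (?\<beta> + (if p = 2 then 1 else 0))"
      by (simp add: dvd_power)
    then have "int p dvd u\<^sup>2 - 1"
      using dvd dvd_trans by force
    then have "\<not> int p dvd u"
      using p1 by (metis dvd_diff_right_iff dvd_power dvd_trans zero_less_numeral)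
    then have u1: "[u = 1] (mod int p ^ ?\<beta>) \<or> [u = - 1] (mod int p ^ ?\<beta>)"
      using prime_power_dvd_square_diff[OF p(1) p1 _ dvd] by blast
    have "[c' = u * c] (mod int p ^ ?\<beta>)"
      using cong q by (metis cong_dvd_modulus of_nat_dvd_iff of_nat_power)
    then show "[c' = c] (mod int p ^ ?\<beta>) \<or> [c' = - c] (mod int p ^ ?\<beta>)"
      using u1 cong_mult[OF _ cong_refl, of u _ _ c] cong_trans by fastforce
  qed
next
  assume signs: ?signs
  define S where "S = {p. \<not> [c' = c] (mod int p ^ multiplicity p g)}"
  have "t' > 0"
    using t_pos t by simp
  then obtain P Q where PQ: "t' = P * Q" "coprime P Q" "\<And>p. prime p \<Longrightarrow> p dvd P \<longleftrightarrow> p dvd t' \<and> p \<in> S"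
    using coprime_factorization by metis
  obtain w y where wy: "int P * w + int Q * y = 1"
    using PQ(2) bezout_int[of "int P" "int Q"] by (metis coprime_iff_gcd_eq_1 coprime_int_iff mult.commute)
  let ?u = "int P * w + int Q * (- y)"
  have "[c' = ?u * c] (mod int p ^ multiplicity p g)" if "p \<in> prime_factors g" for p
  proof -
    have p: "prime p" "p dvd g"
      using that by auto
    let ?q = "int p ^ multiplicity p g"
    have "p ^ multiplicity p g dvd 2 * (P * Q)"
      using g(2) multiplicity_dvd[of p g] PQ(1) dvd_trans by blast
    then have q: "?q dvd 2 * int P * int Q"
      by (metis mult.assoc of_nat_dvd_iff of_nat_mult of_nat_numeral of_nat_power)
    have cop: "coprime ?q (int x)" if "\<not> p dvd x" for x
      using p that by (simp add: prime_imp_coprime)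
    show ?thesis
    proof (cases "p \<in> S")
      case False
      then have "?q dvd 2 * int Q"
        using q cop[of P] PQ(3)[OF p(1)] by (metis coprime_dvd_mult_left_iff mult.assoc mult.commute)
      then have "?q dvd 2 * int Q * (y * c)"
        by (rule dvd_mult2)
      moreover have "2 * int Q * (y * c) = (int P * w + int Q * y) * c - ?u * c"
        by (simp add: algebra_simps)
      ultimately have "[c = ?u * c] (mod ?q)"
        by (simp only: cong_iff_dvd_diff wy mult_1)
      then show ?thesis
        using False cong_trans unfolding S_def by blast
    next
      case True
      then have minus: "[c' = - c] (mod ?q)"
        using signs that by (auto simp: S_def)
      have "\<not> p dvd Q"
      proof
        assume "p dvd Q"
        then have "p dvd P"
          using PQ(1,3) p(1) True by simp
        then show False
          using \<open>p dvd Q\<close> PQ(2) p(1) by (metis coprime_common_divisor_nat not_prime_1)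
      qed
      then have "?q dvd 2 * int P"
        using q cop[of Q] by (metis coprime_dvd_mult_left_iff)
      then have "?q dvd 2 * int P * (- w * c)"
        by (rule dvd_mult2)
      moreover have "2 * int P * (- w * c) = - ((int P * w + int Q * y) * c) - ?u * c"
        by (simp add: algebra_simps)
      ultimately have "[- c = ?u * c] (mod ?q)"
        by (simp only: cong_iff_dvd_diff wy mult_1)
      then show ?thesis
        using minus cong_trans by blast
    qed
  qed
  then have "[c' = ?u * c] (mod int g)"
    using cong_iff_cong_prime_powers[OF g(1), of c' "?u * c" 1] by simp
  moreover have "t = int P * int Q" "int P * w - int Q * (- y) = 1"
    using PQ(1) wy by (simp_all add: t)
  moreover have "int g dvd 2 * t"
    using g(2) unfolding t by (metis of_nat_dvd_iff of_nat_mult of_nat_numeral)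
  ultimately show ?orbit
    using c g(1) unfolding admissible_def
    by (intro orbit_normal_form_mult[of "int P" "int Q" w "- y"]) simp_all
qed

text \<open>
  The map \<open>F\<close> sends a parameter to its local classes up to sign. It separates exactly the orbits, and by
  the Chinese remainder theorem its image is the full product of the sets of local classes.
\<close>

lemma polarization_types_of_std_count:
  assumes t: "t = int t'" and n: "n > 0" and g: "g > 0" "g dvd gcd (2 * t') (2 * n)"
  shows "polarization_types_of \<Lambda> (2 * int n) (int g) \<noteq> {} \<longleftrightarrow>
      (\<forall>p\<in>prime_factors g. local_condition t' n g p)"
    and "(\<forall>p\<in>prime_factors g. local_condition t' n g p) \<Longrightarrow>
      card (polarization_types_of \<Lambda> (2 * int n) (int g)) =
        (\<Prod>p\<in>prime_factors g. local_count t' n g p)"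
proof -
  have t': "t' > 0"
    using t_pos t by simp
  have g2: "g dvd 2 * t'"
    using g(2) by simp
  have \<beta>: "multiplicity p g \<ge> 1" if "p \<in> prime_factors g" for p
    using that by (simp add: Suc_le_eq prime_multiplicity_gt_zero_iff in_prime_factors_iff)
  let ?q = "\<lambda>p. int (p ^ multiplicity p g)"
  let ?C = "{c. admissible (int g) (int n) c}"
  let ?Q = "\<lambda>p. sign_class (?q p) ` {c. locally_admissible t' n p (multiplicity p g) c}"
  define F where "F = (\<lambda>c. \<lambda>p\<in>prime_factors g. sign_class (?q p) c)"
  note adm = admissible_iff_locally_admissible[OF t g(1)]
  have "int g dvd 2 * t"
    using g2 unfolding t by (metis of_nat_dvd_iff of_nat_mult of_nat_numeral)
  then have types: "polarization_types_of \<Lambda> (2 * int n) (int g) =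
      (\<lambda>c. isometry_orbit \<Lambda> (normal_form (int g) (int n) c)) ` ?C"
    using n g(1) by (intro polarization_types_of_std) simp_all
  have "F ` ?C = PiE (prime_factors g) ?Q"
  proof (intro equalityI subsetI)
    fix f assume "f \<in> F ` ?C"
    then show "f \<in> PiE (prime_factors g) ?Q"
      by (auto simp: F_def adm)
  next
    fix f assume f: "f \<in> PiE (prime_factors g) ?Q"
    then have "\<forall>p\<in>prime_factors g. \<exists>c. locally_admissible t' n p (multiplicity p g) c \<and> f p = sign_class (?q p) c"
      by (auto dest!: PiE_mem)
    then obtain r where r: "\<And>p. p \<in> prime_factors g \<Longrightarrow> locally_admissible t' n p (multiplicity p g) (r p)"
      "\<And>p. p \<in> prime_factors g \<Longrightarrow> f p = sign_class (?q p) (r p)"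
      by metis
    obtain c where c: "\<And>p. p \<in> prime_factors g \<Longrightarrow> [c = r p] (mod ?q p)"
      using chinese_remainder_prime_factors[OF g(1)] by blast
    have "locally_admissible t' n p (multiplicity p g) c" if p: "p \<in> prime_factors g" for p
    proof -
      have "p ^ multiplicity p g dvd 2 * t'"
        using g2 multiplicity_dvd dvd_trans by blast
      then show ?thesis
        using locally_admissible_cong[of c "r p" p] c[OF p] r(1)[OF p] \<beta>[OF p] by simp
    qed
    then have "c \<in> ?C"
      by (simp add: adm)
    moreover have "F c = f"
    proof (rule PiE_ext)
      show "F c \<in> (\<Pi>\<^sub>E p\<in>prime_factors g. UNIV)" "f \<in> (\<Pi>\<^sub>E p\<in>prime_factors g. UNIV)"
        using f by (auto simp: F_def PiE_def)
      show "F c p = f p" if "p \<in> prime_factors g" for p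
        using that c[OF that] r(2)[OF that] by (simp add: F_def sign_class_eq_iff)
    qed
    ultimately show "f \<in> F ` ?C"
      by blast
  qed
  note image = this
  have Q_ne: "?Q p \<noteq> {} \<longleftrightarrow> local_condition t' n g p" if "p \<in> prime_factors g" for p
    using that locally_admissible_iff_local_condition[of p t' n g] t' n
    by (auto simp: in_prime_factors_iff)
  have "polarization_types_of \<Lambda> (2 * int n) (int g) \<noteq> {} \<longleftrightarrow> F ` ?C \<noteq> {}"
    unfolding types by simp
  also have "\<dots> \<longleftrightarrow> (\<forall>p\<in>prime_factors g. local_condition t' n g p)"
    unfolding image PiE_eq_empty_iff using Q_ne by blast
  finally show "polarization_types_of \<Lambda> (2 * int n) (int g) \<noteq> {} \<longleftrightarrow>
      (\<forall>p\<in>prime_factors g. local_condition t' n g p)" .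
  assume cond: "\<forall>p\<in>prime_factors g. local_condition t' n g p"
  have "card (polarization_types_of \<Lambda> (2 * int n) (int g)) = card (F ` ?C)"
    unfolding types
  proof (rule card_image_eq_card_image)
    fix c c' assume "c \<in> ?C" "c' \<in> ?C"
    then have "isometry_orbit \<Lambda> (normal_form (int g) (int n) c') = isometry_orbit \<Lambda> (normal_form (int g) (int n) c)
        \<longleftrightarrow> (\<forall>p\<in>prime_factors g. sign_class (?q p) c = sign_class (?q p) c')"
      using orbit_normal_form_iff[OF t g(1) g2, of n c' c]
      by (simp add: isometry_orbit_eq_iff sign_class_eq_iff)
    also have "\<dots> \<longleftrightarrow> F c = F c'"
      by (auto simp: F_def fun_eq_iff restrict_def)
    finally show "isometry_orbit \<Lambda> (normal_form (int g) (int n) c) = isometry_orbit \<Lambda> (normal_form (int g) (int n) c')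
        \<longleftrightarrow> F c = F c'"
      by (metis)
  qed
  also have "\<dots> = (\<Prod>p\<in>prime_factors g. card (?Q p))"
    unfolding image by (rule card_PiE) simp
  also have "\<dots> = (\<Prod>p\<in>prime_factors g. local_count t' n g p)"
    using cond t' n g card_locally_admissible by (intro prod.cong) (auto simp: in_prime_factors_iff)
  finally show "card (polarization_types_of \<Lambda> (2 * int n) (int g)) =
      (\<Prod>p\<in>prime_factors g. local_count t' n g p)" .
qed

end

lemma polarization_types_count_isometric:
  fixes L :: "'a::ab_group_add lattice_form" and N :: "'n::ab_group_add lattice_form" and n g t :: nat
  assumes L: "isometric L (std_lattice (int t) N)" and N: "even_unimodular N"
    and pos: "t > 0" "n > 0" "g > 0" and g: "g dvd gcd (2 * t) (2 * n)"
  shows "((\<exists>T. T \<in> polarization_types_of L (2 * int n) (int g)) \<longleftrightarrow>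
           (\<forall>p\<in>prime_factors g. local_condition t n g p)) \<and>
         ((\<forall>p\<in>prime_factors g. local_condition t n g p) \<longrightarrow>
           card (polarization_types_of L (2 * int n) (int g)) =
             (\<Prod>p\<in>prime_factors g. local_count t n g p))"
proof -
  interpret eichler_lattice N "int t"
    using N pos(1) by (simp add: eichler_lattice_def eichler_lattice_axioms_def)
  have "2 * int n > 0"
    using pos(2) by simp
  then obtain F where F: "bij_betw F (polarization_types_of L (2 * int n) (int g))
      (polarization_types_of (std_lattice (int t) N) (2 * int n) (int g))"
    using isometric_polarization_types[OF L] by metis
  note count = polarization_types_of_std_count[OF refl pos(2,3) g]
  have "polarization_types_of L (2 * int n) (int g) \<noteq> {} \<longleftrightarrow>
      polarization_types_of (std_lattice (int t) N) (2 * int n) (int g) \<noteq> {}"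
    using F by (metis bij_betw_empty1 bij_betw_empty2)
  then show ?thesis
    using count bij_betw_same_card[OF F] by auto
qed

theorem proposition3p5:
  fixes L :: "'a::ab_group_add lattice_form" and m n \<gamma> mt :: nat
  assumes "m \<ge> 2" and "n > 0" and "\<gamma> > 0"
    and "isometric L (K3_lattice m) \<and> mt = m - 1 \<or> isometric L (Kum_lattice m) \<and> mt = m + 1"
    and "\<gamma> dvd gcd (2 * mt) (2 * n)"
  shows "((\<exists>T. T \<in> polarization_types_of L (2 * int n) (int \<gamma>)) \<longleftrightarrow>
           (\<forall>p\<in>prime_factors \<gamma>. local_condition mt n \<gamma> p)) \<and>
         ((\<forall>p\<in>prime_factors \<gamma>. local_condition mt n \<gamma> p) \<longrightarrow>
           card (polarization_types_of L (2 * int n) (int \<gamma>)) =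
             (\<Prod>p\<in>prime_factors \<gamma>. local_count mt n \<gamma> p))"
  using assms(4)
proof
  assume "isometric L (K3_lattice m) \<and> mt = m - 1"
  then show ?thesis
    using assms isometric_trans[of L, OF _ K3_lattice_isometric[of m]]
      even_unimodular_direct_sum[OF even_unimodular_U
        even_unimodular_direct_sum[OF even_unimodular_E8 even_unimodular_E8]]
    by (intro polarization_types_count_isometric) auto
next
  assume "isometric L (Kum_lattice m) \<and> mt = m + 1"
  then show ?thesis
    using assms isometric_trans[of L, OF _ Kum_lattice_isometric[of m]] even_unimodular_U
    by (intro polarization_types_count_isometric) auto
qed

end
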